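(* Let $D\subset\mathbb{C}^n$ be an open invariant set. Every slice regular function $f\in\mathcal{SR}(\Omega_D)$ is separately biharmonic in each variable, i.e. $\Delta_m^2f=0$ on $\Omega_D$ for every $m=1,\dots,n$.
   Context: $\mathbb{H}$ denotes the quaternions, $\mathbb{S}_\mathbb{H}=\{J\in\mathbb{H}: J^2=-1\}$, $\mathcal{P}(n)$ is the power set of $\{1,\dots,n\}$. For $K=\{k_1<\dots<k_p\}$ and quaternions $q_k$, $q_K:=q_{k_1}\cdots q_{k_p}$ (increasing order), $q_\emptyset:=1$. For $z\in\mathbb{C}^n$ write $z_h=\alpha_h+i\beta_h$ with $\alpha_h,\beta_h\in\mathbb{R}$, and let $\overline z^h$ be $z$ with $z_h$ replaced by $\overline{z_h}$. $D\subset\mathbb{C}^n$ is invariant if $z\in D\iff\overline z^h\in D$ for all $h$. Let $\{e_K\}_{K\in\mathcal{P}(n)}$ be a basis of $\mathbb{R}^{2^n}$. A stem function on $D$ is a continuous $F=\sum_{K\in\mathcal{P}(n)}e_KF_K:D\to\mathbb{H}\otimes\mathbb{R}^{2^n}$ ($F_K$ $\mathbb{H}$-valued) with $F_K(\overline z^h)=(-1)^{|K\cap\{h\}|}F_K(z)$ for all $K,h$. The circularization of $D$ is $\Omega_D=\{(\alpha_1+J_1\beta_1,\dots,\alpha_n+J_n\beta_n): (\alpha_1+i\beta_1,\dots,\alpha_n+i\beta_n)\in D,\ J_1,\dots,J_n\in\mathbb{S}_\mathbb{H}\}\subset\mathbb{H}^n$. $F$ induces the slice function $f=\mathcal{I}(F):\Omega_D\to\mathbb{H}$,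 $f(x)=\sum_{K}J_KF_K(z)$ for $x=(\alpha_h+J_h\beta_h)_h$, $z=(\alpha_h+i\beta_h)_h$. $\mathcal{J}_h(q\otimes e_K)=(-1)^{|K\cap\{h\}|}q\otimes e_{K\Delta\{h\}}$ ($\Delta$ between sets = symmetric difference) and $\overline\partial_h=\frac12(\partial/\partial\alpha_h+\mathcal{J}_h\,\partial/\partial\beta_h)$. A $C^1$ stem function $F$ is holomorphic if $\overline\partial_hF=0$ for every $h=1,\dots,n$; $f=\mathcal{I}(F)$ is slice regular if $F$ is holomorphic. $\mathcal{SR}(\Omega_D)$ is the set of slice regular functions on $\Omega_D$. $\Delta_m$ is the Laplacian of $\mathbb{R}^4$ in the four real coordinates of the quaternionic variable $x_m$. *)

theory Defs
  imports "HOL-Analysis.Analysis"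
begin

section \<open>The quaternions as a real normed division algebra\<close>

datatype quat = Quat (q_re: real) (q_i: real) (q_j: real) (q_k: real)

lemma quat_eq_iff:
  "x = y \<longleftrightarrow> q_re x = q_re y \<and> q_i x = q_i y \<and> q_j x = q_j y \<and> q_k x = q_k y"
  by (cases x; cases y) auto

instantiation quat :: real_vector
begin

definition "0 = Quat 0 0 0 0"
definition "x + y = Quat (q_re x + q_re y) (q_i x + q_i y) (q_j x + q_j y) (q_k x + q_k y)"
definition "- x = Quat (- q_re x) (- q_i x) (- q_j x) (- q_k x)"
definition "x - y = Quat (q_re x - q_re y) (q_i x - q_i y) (q_j x - q_j y) (q_k x - q_k y)"
definition "r *\<^sub>R x = Quat (r * q_re x) (r * q_i x) (r * q_j x) (r * q_k x)"

lemma quat_linear_sel [simp]: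
  "q_re 0 = 0" "q_i 0 = 0" "q_j 0 = 0" "q_k 0 = 0"
  "q_re (x + y) = q_re x + q_re y" "q_i (x + y) = q_i x + q_i y"
  "q_j (x + y) = q_j x + q_j y" "q_k (x + y) = q_k x + q_k y"
  "q_re (- x) = - q_re x" "q_i (- x) = - q_i x" "q_j (- x) = - q_j x" "q_k (- x) = - q_k x"
  "q_re (x - y) = q_re x - q_re y" "q_i (x - y) = q_i x - q_i y"
  "q_j (x - y) = q_j x - q_j y" "q_k (x - y) = q_k x - q_k y"
  "q_re (r *\<^sub>R x) = r * q_re x" "q_i (r *\<^sub>R x) = r * q_i x"
  "q_j (r *\<^sub>R x) = r * q_j x" "q_k (r *\<^sub>R x) = r * q_k x"
  by (simp_all add: zero_quat_def plus_quat_def uminus_quat_def minus_quat_def scaleR_quat_def)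

instance
  by standard (simp_all add: quat_eq_iff algebra_simps)

end

instantiation quat :: real_inner
begin

definition "inner x y = q_re x * q_re y + q_i x * q_i y + q_j x * q_j y + q_k x * q_k y"
  for x y :: quat
definition "norm x = sqrt (inner x x)" for x :: quat
definition "sgn x = x /\<^sub>R norm x" for x :: quat
definition "dist x y = norm (x - y)" for x y :: quat
definition uniformity_quat_def:
  "(uniformity :: (quat \<times> quat) filter) = (INF e\<in>{0 <..}. principal {(x, y). dist x y < e})"
definition open_quat_def:
  "open (U :: quat set) \<longleftrightarrow> (\<forall>x\<in>U. eventually (\<lambda>(x', y). x' = x \<longrightarrow> y \<in> U) uniformity)"

instance
proof
  fix x y z :: quat and r :: real and U :: "quat set"
  show "inner x x = 0 \<longleftrightarrow> x = 0"
    by (simp add: inner_quat_def quat_eq_iff add_nonneg_eq_0_iff)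
qed (simp_all add: inner_quat_def norm_quat_def sgn_quat_def dist_quat_def
      uniformity_quat_def open_quat_def algebra_simps)

end

instantiation quat :: euclidean_space
begin

definition "Basis = {Quat 1 0 0 0, Quat 0 1 0 0, Quat 0 0 1 0, Quat 0 0 0 1}"

instance
proof
  fix x u v :: quat
  show "inner u v = (if u = v then 1 else 0)" if "u \<in> Basis" "v \<in> Basis"
    using that unfolding Basis_quat_def by (elim insertE emptyE) (simp_all add: inner_quat_def)
  show "(\<forall>u\<in>Basis. inner x u = 0) \<longleftrightarrow> x = 0"
    unfolding Basis_quat_def ball_simps quat_eq_iff[of x] by (simp add: inner_quat_def)
qed (simp_all add: Basis_quat_def)

end

lemma euler_four_squares:
  fixes a b c d e f g h :: real
  shows "(a*e - b*f - c*g - d*h)\<^sup>2 + (a*f + b*e + c*h - d*g)\<^sup>2 +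
      (a*g - b*h + c*e + d*f)\<^sup>2 + (a*h + b*g - c*f + d*e)\<^sup>2 =
    (a\<^sup>2 + b\<^sup>2 + c\<^sup>2 + d\<^sup>2) * (e\<^sup>2 + f\<^sup>2 + g\<^sup>2 + h\<^sup>2)"
  by (simp add: power2_eq_square algebra_simps)

instantiation quat :: real_normed_div_algebra
begin

definition "1 = Quat 1 0 0 0"
definition "x * y = Quat
   (q_re x * q_re y - q_i x * q_i y - q_j x * q_j y - q_k x * q_k y)
   (q_re x * q_i y + q_i x * q_re y + q_j x * q_k y - q_k x * q_j y)
   (q_re x * q_j y - q_i x * q_k y + q_j x * q_re y + q_k x * q_i y)
   (q_re x * q_k y + q_i x * q_j y - q_j x * q_i y + q_k x * q_re y)"
definition "inverse x = Quat (q_re x) (- q_i x) (- q_j x) (- q_k x) /\<^sub>R (norm x)\<^sup>2"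
definition "x div y = x * inverse y" for x y :: quat

lemma quat_mult_sel [simp]:
  "q_re 1 = 1" "q_i 1 = 0" "q_j 1 = 0" "q_k 1 = 0"
  "q_re (x * y) = q_re x * q_re y - q_i x * q_i y - q_j x * q_j y - q_k x * q_k y"
  "q_i (x * y) = q_re x * q_i y + q_i x * q_re y + q_j x * q_k y - q_k x * q_j y"
  "q_j (x * y) = q_re x * q_j y - q_i x * q_k y + q_j x * q_re y + q_k x * q_i y"
  "q_k (x * y) = q_re x * q_k y + q_i x * q_j y - q_j x * q_i y + q_k x * q_re y"
  by (simp_all add: one_quat_def times_quat_def)

lemma quat_norm_square: "(norm x)\<^sup>2 = (q_re x)\<^sup>2 + (q_i x)\<^sup>2 + (q_j x)\<^sup>2 + (q_k x)\<^sup>2" for x :: quat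
  unfolding power2_norm_eq_inner inner_quat_def by (simp add: power2_eq_square)

instance
proof
  fix x y z :: quat and r :: real
  show "x * y * z = x * (y * z)" "(x + y) * z = x * z + y * z" "x * (y + z) = x * y + x * z"
    "r *\<^sub>R x * y = r *\<^sub>R (x * y)" "x * r *\<^sub>R y = r *\<^sub>R (x * y)"
    by (simp_all add: quat_eq_iff algebra_simps)
  show "1 * x = x" "x * 1 = x" "(0::quat) \<noteq> 1"
    by (simp_all add: quat_eq_iff)
  show "inverse 0 = (0::quat)" "x div y = x * inverse y"
    by (simp_all add: inverse_quat_def divide_quat_def)
  have conj: "x * Quat (q_re x) (- q_i x) (- q_j x) (- q_k x) = (norm x)\<^sup>2 *\<^sub>R 1"
    "Quat (q_re x) (- q_i x) (- q_j x) (- q_k x) * x = (norm x)\<^sup>2 *\<^sub>R 1"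
    unfolding quat_norm_square quat_eq_iff by (simp_all add: power2_eq_square)
  have scale: "a * s *\<^sub>R b = s *\<^sub>R (a * b)" "s *\<^sub>R a * b = s *\<^sub>R (a * b)" for a b :: quat and s
    by (simp_all add: quat_eq_iff algebra_simps)
  show "inverse x * x = 1" "x * inverse x = 1" if "x \<noteq> 0"
    using that by (simp_all add: inverse_quat_def scale conj)
  have "(norm (x * y))\<^sup>2 = (norm x * norm y)\<^sup>2"
    unfolding quat_norm_square power_mult_distrib quat_mult_sel by (rule euler_four_squares)
  then show "norm (x * y) = norm x * norm y"
    by (rule power2_eq_imp_eq) simp_all
qed

end

definition imag_units :: "quat set"
  where "imag_units = {J. J\<^sup>2 = - 1}"


section \<open>Partial derivatives, Laplacian, functions of class \<open>C\<^sup>k\<close>\<close>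

definition dir_deriv ::
    "'a::real_normed_vector \<Rightarrow> ('a \<Rightarrow> 'b::real_normed_vector) \<Rightarrow> 'a \<Rightarrow> 'b"
  where "dir_deriv b g x = vector_derivative (\<lambda>t. g (x + t *\<^sub>R b)) (at 0)"

text \<open>Intended for open sets. Since \<open>Basis\<close> consists of the coordinate vectors, this is the usual
  definition by iterated partial derivatives; on \<open>complex^'n\<close> the coordinates are the real and
  imaginary parts \<open>\<alpha>\<^sub>h\<close>, \<open>\<beta>\<^sub>h\<close> of the components.\<close>

fun Ck_on :: "nat \<Rightarrow> ('a::euclidean_space \<Rightarrow> 'b::real_normed_vector) \<Rightarrow> 'a set \<Rightarrow> bool" where
  "Ck_on 0 g S \<longleftrightarrow> continuous_on S g"
| "Ck_on (Suc k) g S \<longleftrightarrow> continuous_on S g \<and>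
     (\<forall>b\<in>Basis. (\<forall>x\<in>S. (\<lambda>t. g (x + t *\<^sub>R b)) differentiable (at 0)) \<and> Ck_on k (dir_deriv b g) S)"

definition laplacian :: "('a::euclidean_space \<Rightarrow> 'b::real_normed_vector) \<Rightarrow> 'a \<Rightarrow> 'b"
  where "laplacian g x = (\<Sum>b\<in>Basis. dir_deriv b (dir_deriv b g) x)"

definition replace_at :: "'a^'n \<Rightarrow> 'n::finite \<Rightarrow> 'a \<Rightarrow> 'a^'n"
  where "replace_at x m q = (\<chi> h. if h = m then q else x $ h)"

definition var_laplacian :: "'n::finite \<Rightarrow> (quat^'n \<Rightarrow> quat) \<Rightarrow> quat^'n \<Rightarrow> quat"
  where "var_laplacian m f x = laplacian (\<lambda>q. f (replace_at x m q)) (x $ m)"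

text \<open>The function obtained from \<open>f\<close> by freezing all variables but the \<open>m\<close>-th is \<open>C\<^sup>k\<close> on its
  natural domain, for all values of the other variables.\<close>

definition Ck_in_var :: "nat \<Rightarrow> 'n::finite \<Rightarrow> (quat^'n \<Rightarrow> quat) \<Rightarrow> (quat^'n) set \<Rightarrow> bool"
  where "Ck_in_var k m f \<Omega> \<longleftrightarrow>
    (\<forall>x. Ck_on k (\<lambda>q. f (replace_at x m q)) {q. replace_at x m q \<in> \<Omega>})"

text \<open>On total functions, derivatives that do not exist have unspecified values; \<open>\<Delta>\<^sub>m\<^sup>2 f = 0\<close>
  therefore has to come with the regularity that makes \<open>\<Delta>\<^sub>m\<^sup>2 f\<close> meaningful.\<close>

definition separately_biharmonic_on :: "(quat^'n::finite \<Rightarrow> quat) \<Rightarrow> (quat^'n) set \<Rightarrow> bool"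
  where "separately_biharmonic_on f \<Omega> \<longleftrightarrow>
    (\<forall>m. Ck_in_var 4 m f \<Omega> \<and> (\<forall>x\<in>\<Omega>. (var_laplacian m ^^ 2) f x = 0))"


section \<open>Slice regular functions of several quaternionic variables\<close>

text \<open>The index set \<open>{1,\<dots>,n}\<close> is rendered by a finite linearly ordered type \<open>'n\<close>, so that
  \<open>\<P>(n)\<close> becomes the finite type \<open>'n set\<close>.\<close>

definition invariant :: "(complex^'n::finite) set \<Rightarrow> bool"
  where "invariant D \<longleftrightarrow> (\<forall>z h. z \<in> D \<longleftrightarrow> replace_at z h (cnj (z $ h)) \<in> D)"

definition ordered_prod :: "('n::{finite,linorder} \<Rightarrow> quat) \<Rightarrow> 'n set \<Rightarrow> quat"
  where "ordered_prod q K = prod_list (map q (sorted_list_of_set K))"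

definition slice_point :: "complex^'n::finite \<Rightarrow> ('n \<Rightarrow> quat) \<Rightarrow> quat^'n"
  where "slice_point z J = (\<chi> h. of_real (Re (z $ h)) + J h * of_real (Im (z $ h)))"

definition circularization :: "(complex^'n::finite) set \<Rightarrow> (quat^'n) set"
  where "circularization D = {slice_point z J | z J. z \<in> D \<and> (\<forall>h. J h \<in> imag_units)}"

text \<open>An element \<open>\<Sum>\<^sub>K w\<^sub>K \<otimes> e\<^sub>K\<close> of \<open>quat \<otimes> \<real>\<^bsup>2^n\<^esup>\<close> is represented by its coordinate vector
  \<open>(w\<^sub>K)\<^sub>K\<close> of type \<open>quat^('n set)\<close>; thus \<open>q \<otimes> e\<^sub>K\<close> is \<open>axis K q\<close>.\<close>

definition stem_function_on ::
    "(complex^'n::finite) set \<Rightarrow> (complex^'n \<Rightarrow> quat^('n set)) \<Rightarrow> bool"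
  where "stem_function_on D F \<longleftrightarrow> continuous_on D F \<and>
    (\<forall>z\<in>D. \<forall>K h. F (replace_at z h (cnj (z $ h))) $ K = (- 1) ^ card (K \<inter> {h}) * F z $ K)"

definition stem_J :: "'n::finite \<Rightarrow> quat^('n set) \<Rightarrow> quat^('n set)"
  where "stem_J h w = (\<Sum>K\<in>UNIV. axis (sym_diff K {h}) ((- 1) ^ card (K \<inter> {h}) * w $ K))"

definition stem_dbar ::
    "'n::finite \<Rightarrow> (complex^'n \<Rightarrow> quat^('n set)) \<Rightarrow> complex^'n \<Rightarrow> quat^('n set)"
  where "stem_dbar h F z =
    (1/2) *\<^sub>R (dir_deriv (axis h 1) F z + stem_J h (dir_deriv (axis h \<i>) F z))"

definition holomorphic_stem_on ::
    "(complex^'n::finite) set \<Rightarrow> (complex^'n \<Rightarrow> quat^('n set)) \<Rightarrow> bool"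
  where "holomorphic_stem_on D F \<longleftrightarrow>
    stem_function_on D F \<and> Ck_on 1 F D \<and> (\<forall>h. \<forall>z\<in>D. stem_dbar h F z = 0)"

text \<open>\<open>f = \<I>(F)\<close> on \<open>\<Omega>\<^sub>D\<close>. The condition ranges over all representations \<open>(z, J)\<close> of a point and so
  determines \<open>f\<close> on \<open>\<Omega>\<^sub>D\<close>; values of \<open>f\<close> elsewhere are irrelevant.\<close>

definition induced_by ::
    "(complex^'n::{finite,linorder}) set \<Rightarrow>
      (complex^'n::{finite,linorder} \<Rightarrow> quat^('n set)) \<Rightarrow>
      (quat^'n::{finite,linorder} \<Rightarrow> quat) \<Rightarrow> bool"
  where "induced_by D F f \<longleftrightarrow> (\<forall>z\<in>D. \<forall>J. (\<forall>h. J h \<in> imag_units) \<longrightarrow>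
    f (slice_point z J) = (\<Sum>K\<in>UNIV. ordered_prod J K * F z $ K))"

definition slice_regular_functions ::
    "(complex^'n::{finite,linorder}) set \<Rightarrow> (quat^'n::{finite,linorder} \<Rightarrow> quat) set"
  where "slice_regular_functions D = {f. \<exists>F. holomorphic_stem_on D F \<and> induced_by D F f}"

end

theory Submission
  imports Defs "HOL-Complex_Analysis.Complex_Analysis"
begin

text \<open>
  Freeze all variables but the \<open>m\<close>-th. On a slice, the coefficients of \<open>e\<^sub>K\<close> and \<open>e\<^bsub>K \<union> {m}\<^esub>\<close>
  (with \<open>m \<notin> K\<close>) in the stem function form, in each real coordinate of the quaternions, a function
  \<open>u = u\<^sub>1 + i u\<^sub>2\<close> of one complex variable \<open>w = \<alpha> + i \<beta>\<close>. The equation \<open>\<partial>\<close>-bar \<open>= 0\<close> is the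
  Cauchy-Riemann system for \<open>u\<close>, and the parity conditions say that \<open>u\<close> commutes with complex
  conjugation. The imaginary unit of \<open>x\<^sub>m\<close> enters each ordered product at most once, so that
  the product is either independent of it or real-linear in it. With \<open>q = \<alpha> + v\<close> and \<open>\<beta> = |v|\<close>,
  the restricted slice function is therefore a finite sum of constants times the scalar functions \<open>u\<^sub>1(\<alpha>, |v|)\<close> and \<open>v\<^sub>i u\<^sub>2(\<alpha>, |v|) / |v|\<close>
  (\<open>slice_function_one_variable\<close>).

  It remains to see that these scalar functions are smooth and biharmonic on \<open>\<real>\<^sup>4\<close>, including at the
  real axis \<open>v = 0\<close>, where \<open>|v|\<close> is not differentiable. Cauchy's formula settles both points at once.
  The half sum and the half difference of the Cauchy kernels at \<open>w\<close> and at its conjugate lead to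
  the kernels \<open>y\<^sub>i / (y\<^sub>0\<^sup>2 + y\<^sub>1\<^sup>2 + y\<^sub>2\<^sup>2 + y\<^sub>3\<^sup>2)\<close>, where \<open>y = q - \<zeta>\<close> has coordinates
  \<open>y\<^sub>0 = \<alpha> - \<zeta>\<close> and \<open>y\<^sub>i = v\<^sub>i\<close>: the square root in \<open>|v|\<close> has disappeared, and what is left is rational in the real
  coordinates of \<open>q\<close> (\<open>slice_Cauchy_integral_formula\<close>). One may differentiate under the integral
  sign as often as one likes, and the kernel is biharmonic for the same reason as on \<open>\<real>\<^sup>4\<close>, where
  \<open>1 / |y|\<^sup>2\<close> is harmonic and \<open>y\<^sub>i / |y|\<^sup>2\<close> has Laplacian \<open>2 \<partial>\<^sub>i (1 / |y|\<^sup>2)\<close>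
  (\<open>laplacian_cauchy_kernel\<close>).
\<close>

section \<open>Functions with continuous iterated partial derivatives\<close>

lemma eventually_line_in_open:
  fixes x b :: "'a::real_normed_vector"
  assumes "open S" "x \<in> S"
  shows "\<forall>\<^sub>F t in nhds 0. x + t *\<^sub>R b \<in> S"
proof -
  have "((\<lambda>t. x + t *\<^sub>R b) \<longlongrightarrow> x + 0 *\<^sub>R b) (nhds 0)"
    by (intro tendsto_intros) (simp add: filterlim_ident)
  then show ?thesis
    using assms by (auto dest: topological_tendstoD)
qed

lemma dir_derivI:
  "((\<lambda>t. g (x + t *\<^sub>R b)) has_vector_derivative d) (at 0) \<Longrightarrow> dir_deriv b g x = d"
  unfolding dir_deriv_def by (rule vector_derivative_at)

lemma has_dir_deriv:
  "(\<lambda>t. g (x + t *\<^sub>R b)) differentiable (at 0) \<Longrightarrow>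
    ((\<lambda>t. g (x + t *\<^sub>R b)) has_vector_derivative dir_deriv b g x) (at 0)"
  unfolding dir_deriv_def by (simp add: vector_derivative_works)

lemma has_dir_deriv_cong:
  fixes f g :: "'a::real_normed_vector \<Rightarrow> 'b::real_normed_vector"
  assumes "open S" "x \<in> S" "\<And>y. y \<in> S \<Longrightarrow> f y = g y"
    and "((\<lambda>t. f (x + t *\<^sub>R b)) has_vector_derivative d) (at 0)"
  shows "((\<lambda>t. g (x + t *\<^sub>R b)) has_vector_derivative d) (at 0)"
proof -
  have "\<forall>\<^sub>F t in nhds 0. f (x + t *\<^sub>R b) = g (x + t *\<^sub>R b)"
    using eventually_line_in_open[OF assms(1,2)] by eventually_elim (rule assms(3))
  with assms(4) show ?thesis
    by (subst (asm) has_vector_derivative_cong_ev) (use assms in auto)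
qed

lemma dir_deriv_cong:
  fixes f g :: "'a::real_normed_vector \<Rightarrow> 'b::real_normed_vector"
  assumes "open S" "x \<in> S" "\<And>y. y \<in> S \<Longrightarrow> f y = g y"
  shows "dir_deriv b f x = dir_deriv b g x"
proof -
  have "((\<lambda>t. f (x + t *\<^sub>R b)) has_vector_derivative d) (at 0) \<longleftrightarrow>
      ((\<lambda>t. g (x + t *\<^sub>R b)) has_vector_derivative d) (at 0)" for d
    using has_dir_deriv_cong[OF assms(1,2)] assms(3) by metis
  then show ?thesis
    unfolding dir_deriv_def vector_derivative_def by simp
qed

lemma laplacian_cong:
  assumes "open S" "x \<in> S" "\<And>y. y \<in> S \<Longrightarrow> f y = g y"
  shows "laplacian f x = laplacian g x"
  unfolding laplacian_def
  by (intro sum.cong refl dir_deriv_cong[OF assms(1,2)] dir_deriv_cong[OF assms(1)]) (use assms in auto)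

lemma Ck_on_imp_continuous_on: "Ck_on k g S \<Longrightarrow> continuous_on S g"
  by (cases k) auto

lemma Ck_on_cong:
  assumes "open S" "\<And>x. x \<in> S \<Longrightarrow> f x = g x" "Ck_on k f S"
  shows "Ck_on k g S"
  using assms(2,3)
proof (induction k arbitrary: f g)
  case 0
  then show ?case using continuous_on_cong by fastforce
next
  case (Suc k)
  have "continuous_on S g"
    using Suc.prems continuous_on_cong by fastforce
  moreover have "(\<lambda>t. g (x + t *\<^sub>R b)) differentiable (at 0)" if "b \<in> Basis" "x \<in> S" for b x
  proof -
    have "((\<lambda>t. f (x + t *\<^sub>R b)) has_vector_derivative dir_deriv b f x) (at 0)"
      using Suc.prems that by (intro has_dir_deriv) auto
    from has_dir_deriv_cong[OF assms(1) that(2) Suc.prems(1) this] show ?thesis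
      by (auto intro: differentiableI_vector)
  qed
  moreover have "Ck_on k (dir_deriv b g) S" if "b \<in> Basis" for b
    using Suc.IH[of "dir_deriv b f"] Suc.prems that dir_deriv_cong[OF assms(1) _ Suc.prems(1)]
    by auto
  ultimately show ?case by simp
qed

text \<open>The recursion behind \<open>Ck_on\<close> speaks of \<open>dir_deriv\<close>, whose values are unspecified where the
  derivative does not exist. On an open set it may be replaced by any function that agrees with
  the derivative on the set, and this is how all later smoothness proofs proceed.\<close>

lemma Ck_on_SucI:
  assumes "open S" "continuous_on S g"
    and "\<And>b. b \<in> Basis \<Longrightarrow> \<exists>g'. Ck_on k g' S \<and>
      (\<forall>x\<in>S. ((\<lambda>t. g (x + t *\<^sub>R b)) has_vector_derivative g' x) (at 0))"
  shows "Ck_on (Suc k) g S"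
proof -
  have "(\<forall>x\<in>S. (\<lambda>t. g (x + t *\<^sub>R b)) differentiable (at 0)) \<and> Ck_on k (dir_deriv b g) S"
    if b: "b \<in> Basis" for b
  proof -
    obtain g' where g': "Ck_on k g' S"
      "\<And>x. x \<in> S \<Longrightarrow> ((\<lambda>t. g (x + t *\<^sub>R b)) has_vector_derivative g' x) (at 0)"
      using assms(3)[OF b] by blast
    from g'(2) have "\<And>x. x \<in> S \<Longrightarrow> g' x = dir_deriv b g x"
      by (rule dir_derivI[symmetric])
    from Ck_on_cong[OF assms(1) this g'(1)] g'(2) show ?thesis
      by (auto intro: differentiableI_vector)
  qed
  with assms(2) show ?thesis by simp
qed

lemma Ck_on_SucD:
  assumes "Ck_on (Suc k) g S" "b \<in> Basis"
  shows "Ck_on k (dir_deriv b g) S"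
    and "x \<in> S \<Longrightarrow> ((\<lambda>t. g (x + t *\<^sub>R b)) has_vector_derivative dir_deriv b g x) (at 0)"
  using assms by (auto intro: has_dir_deriv)

lemma Ck_on_Suc_imp: "Ck_on (Suc k) g S \<Longrightarrow> Ck_on k g S"
proof (induction k arbitrary: g)
  case (Suc k)
  then show ?case by (subst Ck_on.simps) (metis Ck_on.simps(2))
qed auto

lemma Ck_on_le:
  assumes "j \<le> k" "Ck_on k g S"
  shows "Ck_on j g S"
  using assms by (induction rule: dec_induct) (auto intro: Ck_on_Suc_imp simp del: Ck_on.simps)

lemma Ck_on_bounded_linear:
  assumes "open S" "bounded_linear L" "Ck_on k g S"
  shows "Ck_on k (\<lambda>x. L (g x)) S"
  using assms(3)
proof (induction k arbitrary: g)
  case 0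
  then show ?case by (simp add: bounded_linear.continuous_on[OF assms(2)])
next
  case (Suc k)
  show ?case
  proof (rule Ck_on_SucI[OF assms(1)])
    show "continuous_on S (\<lambda>x. L (g x))"
      using Suc.prems by (intro bounded_linear.continuous_on[OF assms(2)]) simp
    show "\<exists>g'. Ck_on k g' S \<and>
        (\<forall>x\<in>S. ((\<lambda>t. L (g (x + t *\<^sub>R b))) has_vector_derivative g' x) (at 0))"
      if "b \<in> Basis" for b
      using Ck_on_SucD[OF Suc.prems that] Suc.IH
      by (intro exI[of _ "\<lambda>x. L (dir_deriv b g x)"])
        (auto intro: bounded_linear.has_vector_derivative[OF assms(2)])
  qed
qed

lemma Ck_on_add:
  assumes "open S" "Ck_on k f S" "Ck_on k g S"
  shows "Ck_on k (\<lambda>x. f x + g x) S"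
  using assms(2,3)
proof (induction k arbitrary: f g)
  case 0
  then show ?case by (simp add: continuous_on_add)
next
  case (Suc k)
  show ?case
  proof (rule Ck_on_SucI[OF assms(1)])
    show "continuous_on S (\<lambda>x. f x + g x)"
      using Suc.prems by (intro continuous_on_add) auto
    show "\<exists>g'. Ck_on k g' S \<and>
        (\<forall>x\<in>S. ((\<lambda>t. f (x + t *\<^sub>R b) + g (x + t *\<^sub>R b)) has_vector_derivative g' x) (at 0))"
      if "b \<in> Basis" for b
      using Ck_on_SucD[OF Suc.prems(1) that] Ck_on_SucD[OF Suc.prems(2) that] Suc.IH
      by (intro exI[of _ "\<lambda>x. dir_deriv b f x + dir_deriv b g x"])
        (auto intro: has_vector_derivative_add)
  qed
qed

lemma Ck_on_zero: "open S \<Longrightarrow> Ck_on k (\<lambda>x. 0) S"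
proof (induction k)
  case (Suc k)
  then show ?case by (intro Ck_on_SucI) (auto intro!: exI[of _ "\<lambda>x. 0"])
qed auto

lemma Ck_on_sum:
  assumes "open S" "\<And>i. i \<in> I \<Longrightarrow> Ck_on k (f i) S"
  shows "Ck_on k (\<lambda>x. \<Sum>i\<in>I. f i x) S"
  using assms(2)
  by (induction I rule: infinite_finite_induct) (auto intro: Ck_on_zero Ck_on_add assms(1))

lemma Ck_on_locally:
  assumes "\<And>x. x \<in> S \<Longrightarrow> \<exists>T. open T \<and> x \<in> T \<and> Ck_on k g T"
  shows "Ck_on k g S"
  using assms
proof (induction k arbitrary: g)
  case 0
  then show ?case
    unfolding Ck_on.simps
    by (intro continuous_at_imp_continuous_on) (metis continuous_on_eq_continuous_at)
next
  case (Suc k)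
  have "continuous_on S g"
    using Suc.prems unfolding Ck_on.simps
    by (intro continuous_at_imp_continuous_on) (metis continuous_on_eq_continuous_at)
  moreover have "(\<lambda>t. g (x + t *\<^sub>R b)) differentiable (at 0)" if "b \<in> Basis" "x \<in> S" for b x
    using Suc.prems[OF that(2)] that by auto
  moreover have "Ck_on k (dir_deriv b g) S" if "b \<in> Basis" for b
    using Suc.prems that by (intro Suc.IH) fastforce
  ultimately show ?case by simp
qed

lemma Ck_on_laplacian:
  assumes "open S" "Ck_on (Suc (Suc k)) g S"
  shows "Ck_on k (laplacian g) S"
proof -
  have "Ck_on k (\<lambda>x. \<Sum>b\<in>Basis. dir_deriv b (dir_deriv b g) x) S"
    using assms by (intro Ck_on_sum Ck_on_SucD) auto
  then show ?thesis by (simp add: laplacian_def[abs_def])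
qed

lemma laplacian_bounded_linear:
  assumes "open S" "bounded_linear L" "Ck_on 2 g S" "x \<in> S"
  shows "laplacian (\<lambda>y. L (g y)) x = L (laplacian g x)"
proof -
  interpret bounded_linear L by fact
  have C: "Ck_on (Suc (Suc 0)) g S" using assms(3) by (simp add: eval_nat_numeral)
  have "dir_deriv b (dir_deriv b (\<lambda>y. L (g y))) x = L (dir_deriv b (dir_deriv b g) x)"
    if b: "b \<in> Basis" for b
  proof -
    have "dir_deriv b (\<lambda>y. L (g y)) y = L (dir_deriv b g y)" if "y \<in> S" for y
      using Ck_on_SucD(2)[OF C b that] by (intro dir_derivI has_vector_derivative)
    then have "dir_deriv b (dir_deriv b (\<lambda>y. L (g y))) x = dir_deriv b (\<lambda>y. L (dir_deriv b g y)) x"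
      by (rule dir_deriv_cong[OF assms(1,4)])
    also have "\<dots> = L (dir_deriv b (dir_deriv b g) x)"
      using Ck_on_SucD(2)[OF Ck_on_SucD(1)[OF C b] b assms(4)]
      by (intro dir_derivI has_vector_derivative)
    finally show ?thesis .
  qed
  then show ?thesis by (simp add: laplacian_def sum)
qed

lemma laplacian_add:
  assumes "open S" "Ck_on 2 f S" "Ck_on 2 g S" "x \<in> S"
  shows "laplacian (\<lambda>y. f y + g y) x = laplacian f x + laplacian g x"
proof -
  have C: "Ck_on (Suc (Suc 0)) f S" "Ck_on (Suc (Suc 0)) g S"
    using assms(2,3) by (simp_all add: eval_nat_numeral)
  have "dir_deriv b (dir_deriv b (\<lambda>y. f y + g y)) x =
      dir_deriv b (dir_deriv b f) x + dir_deriv b (dir_deriv b g) x" if b: "b \<in> Basis" for b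
  proof -
    have "dir_deriv b (\<lambda>y. f y + g y) y = dir_deriv b f y + dir_deriv b g y" if "y \<in> S" for y
      using C[THEN Ck_on_SucD(2), OF b that] by (intro dir_derivI has_vector_derivative_add)
    then have "dir_deriv b (dir_deriv b (\<lambda>y. f y + g y)) x =
        dir_deriv b (\<lambda>y. dir_deriv b f y + dir_deriv b g y) x"
      by (rule dir_deriv_cong[OF assms(1,4)])
    also have "\<dots> = dir_deriv b (dir_deriv b f) x + dir_deriv b (dir_deriv b g) x"
      using C[THEN Ck_on_SucD(1), OF b, THEN Ck_on_SucD(2), OF b assms(4)]
      by (intro dir_derivI has_vector_derivative_add)
    finally show ?thesis .
  qed
  then show ?thesis by (simp add: laplacian_def sum.distrib)
qed

text \<open>The equation \<open>\<Delta>\<^sup>2 g = 0\<close> is bundled with the regularity that makes it stable under sums and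
  linear maps: \<open>dir_deriv\<close> is additive only where the derivatives exist.\<close>

definition biharmonic_on :: "('a::euclidean_space \<Rightarrow> 'b::real_normed_vector) \<Rightarrow> 'a set \<Rightarrow> bool"
  where "biharmonic_on g S \<longleftrightarrow> Ck_on 4 g S \<and> (\<forall>x\<in>S. laplacian (laplacian g) x = 0)"

lemma Ck_on_4D:
  assumes "open S" "Ck_on 4 g S"
  shows "Ck_on 2 g S" "Ck_on 2 (laplacian g) S"
  using assms Ck_on_le[of 2 4 g S] Ck_on_laplacian[of S 2 g] by (simp_all add: eval_nat_numeral)

lemma biharmonic_on_cong:
  assumes "open S" "\<And>x. x \<in> S \<Longrightarrow> f x = g x" "biharmonic_on f S"
  shows "biharmonic_on g S"
  unfolding biharmonic_on_def
proof (intro conjI ballI)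
  show "Ck_on 4 g S"
    using assms(3) by (auto simp: biharmonic_on_def intro: Ck_on_cong[OF assms(1,2)])
  fix x assume x: "x \<in> S"
  have "laplacian f y = laplacian g y" if "y \<in> S" for y
    using laplacian_cong[OF assms(1) that assms(2)] .
  from laplacian_cong[of S x "laplacian f" "laplacian g", OF assms(1) x this] assms(3) x
  show "laplacian (laplacian g) x = 0" by (simp add: biharmonic_on_def)
qed

lemma biharmonic_on_bounded_linear:
  assumes "open S" "bounded_linear L" "biharmonic_on g S"
  shows "biharmonic_on (\<lambda>x. L (g x)) S"
  unfolding biharmonic_on_def
proof (intro conjI ballI)
  have C: "Ck_on 4 g S" using assms(3) by (simp add: biharmonic_on_def)
  show "Ck_on 4 (\<lambda>x. L (g x)) S" by (rule Ck_on_bounded_linear[OF assms(1,2) C])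
  note C2 = Ck_on_4D[OF assms(1) C]
  fix x assume x: "x \<in> S"
  have "laplacian (laplacian (\<lambda>x. L (g x))) x = laplacian (\<lambda>y. L (laplacian g y)) x"
    by (rule laplacian_cong[OF assms(1) x]) (rule laplacian_bounded_linear[OF assms(1,2) C2(1)])
  also have "\<dots> = L (laplacian (laplacian g) x)"
    by (rule laplacian_bounded_linear[OF assms(1,2) C2(2) x])
  also have "\<dots> = 0"
    using assms(3) x linear_0[OF bounded_linear.linear[OF assms(2)]] by (simp add: biharmonic_on_def)
  finally show "laplacian (laplacian (\<lambda>x. L (g x))) x = 0" .
qed

lemma biharmonic_on_add:
  assumes "open S" "biharmonic_on f S" "biharmonic_on g S"
  shows "biharmonic_on (\<lambda>x. f x + g x) S"
  unfolding biharmonic_on_def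
proof (intro conjI ballI)
  have C: "Ck_on 4 f S" "Ck_on 4 g S" using assms(2,3) by (simp_all add: biharmonic_on_def)
  show "Ck_on 4 (\<lambda>x. f x + g x) S" by (rule Ck_on_add[OF assms(1) C])
  note F = Ck_on_4D[OF assms(1) C(1)] and G = Ck_on_4D[OF assms(1) C(2)]
  fix x assume x: "x \<in> S"
  have "laplacian (laplacian (\<lambda>x. f x + g x)) x = laplacian (\<lambda>y. laplacian f y + laplacian g y) x"
    by (rule laplacian_cong[OF assms(1) x]) (rule laplacian_add[OF assms(1) F(1) G(1)])
  also have "\<dots> = 0"
    using assms(2,3) x by (simp add: biharmonic_on_def laplacian_add[OF assms(1) F(2) G(2) x])
  finally show "laplacian (laplacian (\<lambda>x. f x + g x)) x = 0" .
qed

lemma laplacian_zero: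
  "laplacian (\<lambda>x::'a::euclidean_space. 0 :: 'b::real_normed_vector) x = 0"
proof -
  have "dir_deriv b (\<lambda>x::'a. 0 :: 'b) = (\<lambda>x. 0)" for b
    by (rule ext) (rule dir_derivI, simp)
  then show ?thesis by (simp add: laplacian_def)
qed

lemma biharmonic_on_sum:
  assumes "open S" "\<And>i. i \<in> I \<Longrightarrow> biharmonic_on (f i) S"
  shows "biharmonic_on (\<lambda>x. \<Sum>i\<in>I. f i x) S"
proof -
  have 0: "biharmonic_on (\<lambda>x. 0) S"
    using assms(1) by (simp add: biharmonic_on_def Ck_on_zero laplacian_zero[abs_def])
  show ?thesis
    using assms(2)
    by (induction I rule: infinite_finite_induct) (auto intro: 0 biharmonic_on_add assms(1))
qed

lemma biharmonic_on_locally: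
  assumes "\<And>x. x \<in> S \<Longrightarrow> \<exists>T. open T \<and> x \<in> T \<and> biharmonic_on g T"
  shows "biharmonic_on g S"
  unfolding biharmonic_on_def
proof (intro conjI ballI Ck_on_locally)
  fix x assume x: "x \<in> S"
  show "\<exists>T. open T \<and> x \<in> T \<and> Ck_on 4 g T"
    using assms[OF x] by (auto simp: biharmonic_on_def)
  show "laplacian (laplacian g) x = 0"
    using assms[OF x] by (auto simp: biharmonic_on_def)
qed

section \<open>Integrals of rational kernels\<close>

lemma has_dir_deriv_integral:
  fixes K K' :: "real \<Rightarrow> 'a::real_normed_vector \<Rightarrow> 'b::banach"
  assumes "open S" "q \<in> S"
    and K: "continuous_on (S \<times> {0..1}) (\<lambda>(q, t). K t q)"
    and K': "continuous_on (S \<times> {0..1}) (\<lambda>(q, t). K' t q)"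
    and deriv: "\<And>t q. t \<in> {0..1} \<Longrightarrow> q \<in> S \<Longrightarrow>
      ((\<lambda>s. K t (q + s *\<^sub>R b)) has_vector_derivative K' t q) (at 0)"
  shows "((\<lambda>s. integral {0..1} (\<lambda>t. K t (q + s *\<^sub>R b)))
    has_vector_derivative integral {0..1} (\<lambda>t. K' t q)) (at 0)"
proof -
  obtain e where e: "e > 0" and "\<And>s. dist s 0 < e \<Longrightarrow> q + s *\<^sub>R b \<in> S"
    using eventually_line_in_open[OF assms(1,2), of b] unfolding eventually_nhds_metric by blast
  then have inS: "q + s *\<^sub>R b \<in> S" if "s \<in> ball 0 e" for s
    using that by (simp add: dist_commute)
  have "((\<lambda>s. integral (cbox 0 1) (\<lambda>t. K t (q + s *\<^sub>R b)))
      has_vector_derivative integral (cbox 0 1) (\<lambda>t. K' t (q + 0 *\<^sub>R b))) (at 0 within ball 0 e)"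
  proof (rule leibniz_rule_vector_derivative)
    fix s t :: real assume s: "s \<in> ball 0 e" and "t \<in> cbox 0 1"
    then have t: "t \<in> {0..1}" by simp
    have "((\<lambda>r. r - s) has_vector_derivative 1) (at s)"
      by (auto intro!: derivative_eq_intros)
    moreover have "((\<lambda>r. K t (q + s *\<^sub>R b + r *\<^sub>R b)) has_vector_derivative K' t (q + s *\<^sub>R b))
        (at (s - s))"
      using deriv[OF t inS[OF s]] by simp
    ultimately have "((\<lambda>r. K t (q + s *\<^sub>R b + r *\<^sub>R b)) \<circ> (\<lambda>r. r - s)
        has_vector_derivative 1 *\<^sub>R K' t (q + s *\<^sub>R b)) (at s)"
      by (rule vector_diff_chain_at)
    moreover have "(\<lambda>r. K t (q + s *\<^sub>R b + r *\<^sub>R b)) \<circ> (\<lambda>r. r - s) = (\<lambda>r. K t (q + r *\<^sub>R b))"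
      by (simp add: fun_eq_iff algebra_simps)
    ultimately show "((\<lambda>r. K t (q + r *\<^sub>R b)) has_vector_derivative K' t (q + s *\<^sub>R b))
        (at s within ball 0 e)"
      by (simp add: has_vector_derivative_at_within)
  next
    fix s :: real assume "s \<in> ball 0 e"
    then have "continuous_on {0..1} (\<lambda>t. (\<lambda>(q, t). K t q) (q + s *\<^sub>R b, t))"
      by (intro continuous_on_compose2[OF K] continuous_intros) (auto intro: inS)
    then show "(\<lambda>t. K t (q + s *\<^sub>R b)) integrable_on cbox 0 1"
      by (simp add: integrable_continuous_real)
  next
    have "continuous_on (ball (0::real) e \<times> {0..1})
        (\<lambda>p. (\<lambda>(q, t). K' t q) (q + fst p *\<^sub>R b, snd p))"
      by (intro continuous_on_compose2[OF K'] continuous_intros) (auto intro: inS)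
    then show "continuous_on (ball 0 e \<times> cbox 0 1) (\<lambda>(s, t). K' t (q + s *\<^sub>R b))"
      by (simp add: case_prod_unfold)
  qed (use e in auto)
  then show ?thesis
    using e by (simp add: has_vector_derivative_within_open[of 0 "ball 0 e"])
qed

text \<open>The coordinates of \<open>q - \<zeta>\<close> in the complexified quaternions, for \<open>\<zeta>\<close> in the complexified
  real axis. The basis vector \<open>1\<close> spans the real axis.\<close>

definition offset :: "quat \<Rightarrow> complex \<Rightarrow> quat \<Rightarrow> complex"
  where "offset b \<zeta> q = of_real (q \<bullet> b) - (if b = 1 then \<zeta> else 0)"

text \<open>The complex-bilinear extension of the squared Euclidean norm, evaluated at \<open>q - \<zeta>\<close>. Unlike
  a norm it may vanish away from zero; its zeros are the singularities of the kernels below.\<close>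

definition offset_square :: "complex \<Rightarrow> quat \<Rightarrow> complex"
  where "offset_square \<zeta> q = (\<Sum>b\<in>Basis. (offset b \<zeta> q)\<^sup>2)"

lemma offset_line:
  "offset i \<zeta> (q + t *\<^sub>R b) = offset i \<zeta> q + of_real t * of_real (b \<bullet> i)"
  by (simp add: offset_def inner_add_left)

lemma offset_square_line:
  assumes "b \<in> Basis"
  shows "offset_square \<zeta> (q + t *\<^sub>R b) =
    offset_square \<zeta> q + 2 * of_real t * offset b \<zeta> q + (of_real t)\<^sup>2"
proof -
  have "(offset i \<zeta> (q + t *\<^sub>R b))\<^sup>2 = (offset i \<zeta> q)\<^sup>2 +
      (if i = b then 2 * of_real t * offset b \<zeta> q + (of_real t)\<^sup>2 else 0)" if "i \<in> Basis" for i
    using assms that by (simp add: offset_line inner_Basis power2_eq_square algebra_simps)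
  then show ?thesis
    using assms by (simp add: offset_square_def sum.distrib)
qed

lemma has_dir_deriv_offset:
  "((\<lambda>t. offset i \<zeta> (q + t *\<^sub>R b)) has_vector_derivative of_real (b \<bullet> i)) (at 0)"
  unfolding offset_line
  by (rule has_vector_derivative_real_field) (auto intro!: derivative_eq_intros)

lemma has_dir_deriv_inverse_offset_square:
  assumes "b \<in> Basis" "offset_square \<zeta> q \<noteq> 0"
  shows "((\<lambda>t. inverse (offset_square \<zeta> (q + t *\<^sub>R b)) ^ n) has_vector_derivative
    - 2 * of_nat n * (offset b \<zeta> q * inverse (offset_square \<zeta> q) ^ Suc n)) (at 0)"
  unfolding offset_square_line[OF assms(1)]
proof (rule has_vector_derivative_real_field)
  show "((\<lambda>t. inverse (offset_square \<zeta> q + 2 * t * offset b \<zeta> q + t\<^sup>2) ^ n) has_field_derivative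
      - 2 * of_nat n * (offset b \<zeta> q * inverse (offset_square \<zeta> q) ^ Suc n)) (at (of_real 0))"
  proof -
    let ?P = "\<lambda>t. offset_square \<zeta> q + 2 * t * offset b \<zeta> q + t\<^sup>2"
    have "(?P has_field_derivative 2 * offset b \<zeta> q) (at 0)"
      by (auto intro!: derivative_eq_intros)
    from DERIV_power[OF DERIV_inverse'[OF this], of n] assms(2) show ?thesis
      by (cases n) (simp_all add: algebra_simps)
  qed
qed

lemma continuous_on_offset [continuous_intros]:
  assumes "continuous_on S f" "continuous_on S g"
  shows "continuous_on S (\<lambda>x. offset b (f x) (g x))"
  unfolding offset_def by (cases "b = 1") (auto intro!: continuous_intros assms)

lemma continuous_on_offset_square [continuous_intros]:
  assumes "continuous_on S f" "continuous_on S g"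
  shows "continuous_on S (\<lambda>x. offset_square (f x) (g x))"
  unfolding offset_square_def by (intro continuous_intros assms)

lemma open_offset_square_nonzero: "open {q. offset_square \<zeta> q \<noteq> 0}"
  by (intro open_Collect_neq continuous_intros)

text \<open>Each \<open>y\<^sub>b\<close> has derivative \<open>1\<close> in direction \<open>b\<close>, so the computation is that of
  \<open>\<Delta>(y\<^sub>i |y|\<^bsup>-2n\<^esup>)\<close> on \<open>\<real>\<^sup>4\<close>, with complex values of the coordinates. Three terms contribute
  \<open>- 4n\<close> (the mixed derivatives), \<open>- 8n\<close> (\<open>- 2n\<close> for each of the four directions,
  where the factor \<open>y\<^sub>b\<close> from the first differentiation is differentiated) and \<open>4n(n + 1)\<close>,
  adding up to \<open>4n(n - 2)\<close>. The zero at \<open>n = 2\<close> is what makes the kernel with \<open>n = 1\<close> biharmonic.\<close>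

lemma laplacian_cauchy_kernel:
  assumes i: "i \<in> Basis" and "offset_square \<zeta> q \<noteq> 0"
  shows "laplacian (\<lambda>q. c * (offset i \<zeta> q * inverse (offset_square \<zeta> q) ^ n)) q =
    4 * of_nat n * (of_nat n - 2) * (c * (offset i \<zeta> q * inverse (offset_square \<zeta> q) ^ Suc n))"
proof -
  define y where "y = (\<lambda>b. offset b \<zeta>)"
  define V where "V = (\<lambda>q. inverse (offset_square \<zeta> q))"
  define S where "S = {q. offset_square \<zeta> q \<noteq> 0}"
  have S: "open S" "q \<in> S" using assms open_offset_square_nonzero by (auto simp: S_def)
  have dy: "((\<lambda>t. y j (p + t *\<^sub>R b)) has_vector_derivative of_real (b \<bullet> j)) (at 0)" for j p b
    unfolding y_def by (rule has_dir_deriv_offset)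
  have dV: "((\<lambda>t. V (p + t *\<^sub>R b) ^ k) has_vector_derivative - 2 * of_nat k * (y b p * V p ^ Suc k)) (at 0)"
    if "p \<in> S" "b \<in> Basis" for p b k
    using has_dir_deriv_inverse_offset_square[of b \<zeta> p k] that unfolding y_def V_def S_def by simp
  have first: "dir_deriv b (\<lambda>q. c * (y i q * V q ^ n)) p =
      c * (of_real (b \<bullet> i) * V p ^ n - 2 * of_nat n * (y i p * y b p * V p ^ Suc n))"
    if p: "p \<in> S" and b: "b \<in> Basis" for p b
    by (rule dir_derivI)
      (auto intro!: derivative_eq_intros dy dV[OF p b] simp: algebra_simps)
  have second: "dir_deriv b (dir_deriv b (\<lambda>q. c * (y i q * V q ^ n))) q =
      c * (- 4 * of_nat n * (of_real (b \<bullet> i) * y b q * V q ^ Suc n) - 2 * of_nat n * (y i q * V q ^ Suc n)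
        + 4 * of_nat n * of_nat (Suc n) * (y i q * (y b q)\<^sup>2 * V q ^ Suc (Suc n)))"
    if b: "b \<in> Basis" for b
  proof -
    have "dir_deriv b (dir_deriv b (\<lambda>q. c * (y i q * V q ^ n))) q = dir_deriv b (\<lambda>p.
        c * (of_real (b \<bullet> i) * V p ^ n - 2 * of_nat n * (y i p * y b p * V p ^ Suc n))) q"
      by (rule dir_deriv_cong[OF S]) (rule first[OF _ b])
    also have "\<dots> = c * (of_real (b \<bullet> i) * (- 2 * of_nat n * (y b q * V q ^ Suc n))
        - 2 * of_nat n * ((of_real (b \<bullet> i) * y b q + y i q * of_real (b \<bullet> b)) * V q ^ Suc n
          + y i q * y b q * (- 2 * of_nat (Suc n) * (y b q * V q ^ Suc (Suc n)))))"
      by (rule dir_derivI)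
        (rule derivative_eq_intros dy dV[OF S(2) b] refl | simp del: power_Suc add: algebra_simps)+
    finally show ?thesis using b by (simp add: inner_same_Basis algebra_simps power2_eq_square)
  qed
  have card: "card (Basis :: quat set) = 4"
    by (simp add: Basis_quat_def)
  have sum1: "(\<Sum>b\<in>Basis. of_real (b \<bullet> i) * y b q) = y i q"
  proof -
    have "(\<Sum>b\<in>Basis. of_real (b \<bullet> i) * y b q) = (\<Sum>b\<in>Basis. if b = i then y b q else 0)"
      using i by (intro sum.cong) (auto simp: inner_Basis)
    then show ?thesis using i by simp
  qed
  have sum2: "(\<Sum>b\<in>Basis. (y b q)\<^sup>2) * V q = 1"
    using assms(2) by (simp add: y_def V_def offset_square_def)
  have "laplacian (\<lambda>q. c * (y i q * V q ^ n)) q =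
      (\<Sum>b\<in>Basis. - 4 * of_nat n * c * V q ^ Suc n * (of_real (b \<bullet> i) * y b q)
        - 2 * of_nat n * c * (y i q * V q ^ Suc n)
        + 4 * of_nat n * of_nat (Suc n) * c * y i q * V q ^ Suc n * ((y b q)\<^sup>2 * V q))"
    unfolding laplacian_def by (rule sum.cong) (simp_all add: second algebra_simps)
  also have "\<dots> = - 4 * of_nat n * c * V q ^ Suc n * y i q
        - 4 * (2 * of_nat n * c * (y i q * V q ^ Suc n))
        + 4 * of_nat n * of_nat (Suc n) * c * y i q * V q ^ Suc n"
    unfolding sum.distrib sum_subtractf sum_distrib_left[symmetric] sum_distrib_right[symmetric]
      sum1 sum2 by (simp add: card)
  also have "\<dots> = 4 * of_nat n * (of_nat n - 2) * (c * (y i q * V q ^ Suc n))"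
    by (simp add: algebra_simps)
  finally show ?thesis unfolding y_def V_def .
qed

text \<open>A class of kernels that contains the Cauchy kernels and is closed under partial derivatives in
  \<open>q\<close>; this closure makes integrals of its members smooth to every order.\<close>

inductive rational_kernel :: "(real \<Rightarrow> complex) \<Rightarrow> (real \<Rightarrow> quat \<Rightarrow> complex) \<Rightarrow> bool"
  for \<zeta> where
  coefficient: "continuous_on {0..1} c \<Longrightarrow> rational_kernel \<zeta> (\<lambda>t q. c t)"
| offset: "rational_kernel \<zeta> (\<lambda>t q. offset b (\<zeta> t) q)"
| inverse_offset_square: "rational_kernel \<zeta> (\<lambda>t q. inverse (offset_square (\<zeta> t) q))"
| add: "rational_kernel \<zeta> K \<Longrightarrow> rational_kernel \<zeta> L \<Longrightarrow> rational_kernel \<zeta> (\<lambda>t q. K t q + L t q)"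
| mult: "rational_kernel \<zeta> K \<Longrightarrow> rational_kernel \<zeta> L \<Longrightarrow> rational_kernel \<zeta> (\<lambda>t q. K t q * L t q)"

lemma rational_kernel_power:
  "rational_kernel \<zeta> K \<Longrightarrow> rational_kernel \<zeta> (\<lambda>t q. K t q ^ n)"
  by (induction n) (auto intro: rational_kernel.intros)

lemma continuous_on_rational_kernel:
  assumes "rational_kernel \<zeta> K" "continuous_on {0..1} \<zeta>"
    and "\<And>t q. t \<in> {0..1} \<Longrightarrow> q \<in> S \<Longrightarrow> offset_square (\<zeta> t) q \<noteq> 0"
  shows "continuous_on (S \<times> {0..1}) (\<lambda>(q, t). K t q)"
proof -
  have snd: "continuous_on (S \<times> {0..1}) (\<lambda>p. c (snd p))"
    if "continuous_on {0..1} c" for c :: "real \<Rightarrow> complex"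
    by (intro continuous_on_compose2[OF that] continuous_intros) auto
  show ?thesis
    using assms(1) unfolding case_prod_unfold
    by induction (auto intro!: continuous_intros snd assms(2) simp: assms(3))
qed

lemma rational_kernel_deriv:
  assumes "rational_kernel \<zeta> K" "b \<in> Basis"
  shows "\<exists>K'. rational_kernel \<zeta> K' \<and> (\<forall>t q. offset_square (\<zeta> t) q \<noteq> 0 \<longrightarrow>
    ((\<lambda>s. K t (q + s *\<^sub>R b)) has_vector_derivative K' t q) (at 0))"
  using assms(1)
proof induction
  case (coefficient c)
  show ?case
    by (intro exI[of _ "\<lambda>t q. 0"]) (auto intro: rational_kernel.coefficient)
next
  case (offset i)
  show ?case
    by (intro exI[of _ "\<lambda>t q. of_real (b \<bullet> i)"])
      (auto intro: rational_kernel.coefficient has_dir_deriv_offset)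
next
  case inverse_offset_square
  have "rational_kernel \<zeta> (\<lambda>t q. - 2 * (offset b (\<zeta> t) q * inverse (offset_square (\<zeta> t) q) ^ 2))"
    by (intro rational_kernel.intros rational_kernel_power) auto
  moreover have "((\<lambda>s. inverse (offset_square (\<zeta> t) (q + s *\<^sub>R b))) has_vector_derivative
      - 2 * (offset b (\<zeta> t) q * inverse (offset_square (\<zeta> t) q) ^ 2)) (at 0)"
    if "offset_square (\<zeta> t) q \<noteq> 0" for t q
    using has_dir_deriv_inverse_offset_square[OF assms(2) that, of 1] by (simp add: power2_eq_square)
  ultimately show ?case by blast
next
  case (add K L)
  then obtain K' L' where "rational_kernel \<zeta> K'" "rational_kernel \<zeta> L'"
    "\<And>t q. offset_square (\<zeta> t) q \<noteq> 0 \<Longrightarrow> ((\<lambda>s. K t (q + s *\<^sub>R b)) has_vector_derivative K' t q) (at 0)"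
    "\<And>t q. offset_square (\<zeta> t) q \<noteq> 0 \<Longrightarrow> ((\<lambda>s. L t (q + s *\<^sub>R b)) has_vector_derivative L' t q) (at 0)"
    by blast
  then show ?case
    by (intro exI[of _ "\<lambda>t q. K' t q + L' t q"])
      (auto intro: rational_kernel.add has_vector_derivative_add)
next
  case (mult K L)
  then obtain K' L' where K': "rational_kernel \<zeta> K'" "rational_kernel \<zeta> L'"
    "\<And>t q. offset_square (\<zeta> t) q \<noteq> 0 \<Longrightarrow> ((\<lambda>s. K t (q + s *\<^sub>R b)) has_vector_derivative K' t q) (at 0)"
    "\<And>t q. offset_square (\<zeta> t) q \<noteq> 0 \<Longrightarrow> ((\<lambda>s. L t (q + s *\<^sub>R b)) has_vector_derivative L' t q) (at 0)"
    by blast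
  have "((\<lambda>s. K t (q + s *\<^sub>R b) * L t (q + s *\<^sub>R b)) has_vector_derivative
      K t q * L' t q + K' t q * L t q) (at 0)" if "offset_square (\<zeta> t) q \<noteq> 0" for t q
    using has_vector_derivative_mult[OF K'(3,4)[OF that]] by simp
  with K'(1,2) mult.hyps show ?case
    by (intro exI[of _ "\<lambda>t q. K t q * L' t q + K' t q * L t q"])
      (auto intro: rational_kernel.add rational_kernel.mult)
qed

lemma Ck_on_rational_kernel_integral:
  assumes "continuous_on {0..1} \<zeta>" "open S"
    and nz: "\<And>t q. t \<in> {0..1} \<Longrightarrow> q \<in> S \<Longrightarrow> offset_square (\<zeta> t) q \<noteq> 0"
    and "rational_kernel \<zeta> K"
  shows "Ck_on k (\<lambda>q. integral {0..1} (\<lambda>t. K t q)) S"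
  using assms(4)
proof (induction k arbitrary: K)
  case 0
  have "continuous_on S (\<lambda>q. integral (cbox 0 1) (\<lambda>t. K t q))"
    using continuous_on_rational_kernel[OF 0 assms(1) nz]
    by (intro integral_continuous_on_param) simp
  then show ?case by simp
next
  case (Suc k)
  show ?case
  proof (rule Ck_on_SucI[OF assms(2)])
    show "continuous_on S (\<lambda>q. integral {0..1} (\<lambda>t. K t q))"
      using Suc.IH[OF Suc.prems] by (rule Ck_on_imp_continuous_on)
    fix b :: quat assume "b \<in> Basis"
    then obtain K' where K': "rational_kernel \<zeta> K'"
      "\<And>t q. offset_square (\<zeta> t) q \<noteq> 0 \<Longrightarrow> ((\<lambda>s. K t (q + s *\<^sub>R b)) has_vector_derivative K' t q) (at 0)"
      using rational_kernel_deriv[OF Suc.prems] by blast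
    show "\<exists>g'. Ck_on k g' S \<and> (\<forall>q\<in>S. ((\<lambda>s. integral {0..1} (\<lambda>t. K t (q + s *\<^sub>R b)))
        has_vector_derivative g' q) (at 0))"
      using Suc.IH[OF K'(1)]
      by (intro exI[of _ "\<lambda>q. integral {0..1} (\<lambda>t. K' t q)"] conjI ballI has_dir_deriv_integral[of S]
          continuous_on_rational_kernel[OF _ assms(1) nz] assms(2) Suc.prems K' nz) auto
  qed
qed

text \<open>Differentiation under the integral sign, twice. The second derivatives of the kernel are integrable
  because they agree with rational kernels, which are continuous.\<close>

lemma laplacian_rational_kernel_integral:
  assumes "continuous_on {0..1} \<zeta>" "open S" "q \<in> S"
    and nz: "\<And>t q. t \<in> {0..1} \<Longrightarrow> q \<in> S \<Longrightarrow> offset_square (\<zeta> t) q \<noteq> 0"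
    and K: "rational_kernel \<zeta> K"
  shows "laplacian (\<lambda>q. integral {0..1} (\<lambda>t. K t q)) q = integral {0..1} (\<lambda>t. laplacian (K t) q)"
proof -
  note cont = continuous_on_rational_kernel[OF _ assms(1) nz]
  define d where "d = (\<lambda>b t. dir_deriv b (dir_deriv b (K t)) q)"
  have main: "d b integrable_on {0..1} \<and>
      dir_deriv b (dir_deriv b (\<lambda>q. integral {0..1} (\<lambda>t. K t q))) q = integral {0..1} (d b)"
    if b: "b \<in> Basis" for b
  proof -
    obtain K' where K': "rational_kernel \<zeta> K'"
      "\<And>t q. offset_square (\<zeta> t) q \<noteq> 0 \<Longrightarrow> ((\<lambda>s. K t (q + s *\<^sub>R b)) has_vector_derivative K' t q) (at 0)"
      using rational_kernel_deriv[OF K b] by blast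
    obtain K'' where K'': "rational_kernel \<zeta> K''"
      "\<And>t q. offset_square (\<zeta> t) q \<noteq> 0 \<Longrightarrow> ((\<lambda>s. K' t (q + s *\<^sub>R b)) has_vector_derivative K'' t q) (at 0)"
      using rational_kernel_deriv[OF K'(1) b] by blast
    have d: "d b t = K'' t q" if t: "t \<in> {0..1}" for t
    proof -
      have "d b t = dir_deriv b (K' t) q"
        unfolding d_def by (rule dir_deriv_cong[OF assms(2,3)]) (intro dir_derivI K'(2) nz t)
      also have "\<dots> = K'' t q" by (intro dir_derivI K''(2) nz t assms(3))
      finally show ?thesis .
    qed
    have "continuous_on {0..1} (\<lambda>t. (\<lambda>(q, t). K'' t q) (q, t))"
      using assms(3) by (intro continuous_on_compose2[OF cont[OF K''(1)]] continuous_intros) auto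
    then have "(\<lambda>t. K'' t q) integrable_on {0..1}"
      by (simp add: integrable_continuous_real)
    then have "d b integrable_on {0..1}"
      by (rule integrable_eq) (simp add: d)
    moreover have "dir_deriv b (dir_deriv b (\<lambda>q. integral {0..1} (\<lambda>t. K t q))) q =
        dir_deriv b (\<lambda>q. integral {0..1} (\<lambda>t. K' t q)) q"
      by (rule dir_deriv_cong[OF assms(2,3)])
        (intro dir_derivI has_dir_deriv_integral[OF assms(2)] cont K K' nz)
    moreover have "\<dots> = integral {0..1} (\<lambda>t. K'' t q)"
      by (intro dir_derivI has_dir_deriv_integral[OF assms(2,3)] cont K' K'' nz)
    moreover have "\<dots> = integral {0..1} (d b)"
      by (rule Henstock_Kurzweil_Integration.integral_cong) (simp add: d)
    ultimately show ?thesis by simp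
  qed
  have "integral {0..1} (\<lambda>t. laplacian (K t) q) = integral {0..1} (\<lambda>t. \<Sum>b\<in>Basis. d b t)"
    by (simp add: laplacian_def d_def)
  also have "\<dots> = (\<Sum>b\<in>Basis. integral {0..1} (d b))"
    using main by (intro integral_sum) auto
  also have "\<dots> = laplacian (\<lambda>q. integral {0..1} (\<lambda>t. K t q)) q"
    using main by (simp add: laplacian_def)
  finally show ?thesis ..
qed

text \<open>One Laplacian turns the kernel with exponent \<open>1\<close> into \<open>- 4\<close> times the one with exponent
  \<open>2\<close>, which the next Laplacian annihilates.\<close>

lemma biharmonic_on_cauchy_kernel_integral:
  fixes \<zeta> c :: "real \<Rightarrow> complex"
  assumes "continuous_on {0..1} \<zeta>" "continuous_on {0..1} c" "i \<in> Basis" "open S"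
    and nz: "\<And>t q. t \<in> {0..1} \<Longrightarrow> q \<in> S \<Longrightarrow> offset_square (\<zeta> t) q \<noteq> 0"
  shows "biharmonic_on
    (\<lambda>q. integral {0..1} (\<lambda>t. c t * (offset i (\<zeta> t) q * inverse (offset_square (\<zeta> t) q)))) S"
proof -
  define K where "K = (\<lambda>n t q. c t * (offset i (\<zeta> t) q * inverse (offset_square (\<zeta> t) q) ^ n))"
  have K: "rational_kernel \<zeta> (\<lambda>t q. a * K n t q)" for n a
    unfolding K_def by (intro rational_kernel.intros rational_kernel_power assms(2) continuous_on_const)
  have K1: "rational_kernel \<zeta> (K n)" for n
    using K[of 1 n] by simp
  have lap: "laplacian (\<lambda>q. integral {0..1} (\<lambda>t. K t q)) q = integral {0..1} (\<lambda>t. laplacian (K t) q)"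
    if "q \<in> S" "rational_kernel \<zeta> K" for q K
    by (rule laplacian_rational_kernel_integral[OF assms(1,4) that(1) nz that(2)])
  note lapK = laplacian_cauchy_kernel[OF assms(3) nz]
  have "laplacian (\<lambda>q. integral {0..1} (\<lambda>t. K 1 t q)) q = integral {0..1} (\<lambda>t. - 4 * K 2 t q)"
    if q: "q \<in> S" for q
    unfolding lap[OF q K1]
    by (rule Henstock_Kurzweil_Integration.integral_cong)
      (simp add: K_def lapK[OF _ q, where n = 1, simplified] power2_eq_square)
  then have "laplacian (laplacian (\<lambda>q. integral {0..1} (\<lambda>t. K 1 t q))) q =
      laplacian (\<lambda>q. integral {0..1} (\<lambda>t. - 4 * K 2 t q)) q" if q: "q \<in> S" for q
    by (rule laplacian_cong[OF assms(4) q])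
  moreover have "laplacian (\<lambda>q. integral {0..1} (\<lambda>t. - 4 * K 2 t q)) q = 0" if q: "q \<in> S" for q
  proof -
    have "integral {0..1} (\<lambda>t. laplacian (\<lambda>q. - 4 * K 2 t q) q) = integral {0..1} (\<lambda>t::real. 0)"
    proof (rule Henstock_Kurzweil_Integration.integral_cong)
      fix t :: real assume t: "t \<in> {0..1}"
      have "(\<lambda>q. - 4 * K 2 t q) =
          (\<lambda>q. (- 4 * c t) * (offset i (\<zeta> t) q * inverse (offset_square (\<zeta> t) q) ^ 2))"
        by (simp add: K_def fun_eq_iff)
      then show "laplacian (\<lambda>q. - 4 * K 2 t q) q = 0"
        by (simp only: lapK[OF t q]) simp
    qed
    then show ?thesis unfolding lap[OF q K] by simp
  qed
  ultimately show ?thesis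
    using Ck_on_rational_kernel_integral[OF assms(1,4) nz K1[of 1]]
    by (simp add: biharmonic_on_def K_def)
qed

section \<open>The Cauchy formula for slice functions of one quaternionic variable\<close>

text \<open>The point of the closed upper half plane that represents the sphere
  \<open>{\<alpha> + J \<beta>}\<close> through \<open>q\<close>.\<close>

definition slice_coord :: "quat \<Rightarrow> complex"
  where "slice_coord q = Complex (q_re q) (sqrt ((q_i q)\<^sup>2 + (q_j q)\<^sup>2 + (q_k q)\<^sup>2))"

lemma continuous_on_slice_coord: "continuous_on S slice_coord"
proof -
  have eq: "slice_coord = (\<lambda>q. Complex (q \<bullet> Quat 1 0 0 0)
      (sqrt ((q \<bullet> Quat 0 1 0 0)\<^sup>2 + (q \<bullet> Quat 0 0 1 0)\<^sup>2 + (q \<bullet> Quat 0 0 0 1)\<^sup>2)))"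
    by (simp add: slice_coord_def fun_eq_iff inner_quat_def)
  show ?thesis
    by (subst eq) (unfold Complex_eq, intro continuous_intros)
qed

text \<open>The characteristic polynomial of \<open>q\<close>, which vanishes exactly when \<open>\<zeta>\<close> is one of the two complex
  points of the sphere through \<open>q\<close>.\<close>

lemma offset_square_slice_coord:
  "offset_square \<zeta> q = (slice_coord q - \<zeta>) * (cnj (slice_coord q) - \<zeta>)"
proof -
  define s where "s = (q_i q)\<^sup>2 + (q_j q)\<^sup>2 + (q_k q)\<^sup>2"
  have "offset_square \<zeta> q = (of_real (q_re q) - \<zeta>)\<^sup>2 + of_real s"
    by (simp add: offset_square_def Basis_quat_def offset_def one_quat_def inner_quat_def s_def
        add_ac)
  also have "s = (Im (slice_coord q))\<^sup>2"
    by (simp add: s_def slice_coord_def)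
  also have "(of_real (q_re q) - \<zeta>)\<^sup>2 + of_real ((Im (slice_coord q))\<^sup>2) =
      (slice_coord q - \<zeta>) * (cnj (slice_coord q) - \<zeta>)"
    by (simp add: slice_coord_def complex_eq_iff power2_eq_square algebra_simps)
  finally show ?thesis .
qed

text \<open>A point off the real axis and its conjugate may lie in different components of the domain, so
  that no single disc surrounds both. With disjoint discs, only the circle around the point
  contributes, and the sum over all circles reproduces \<open>u\<close> in every disc.\<close>

lemma Cauchy_integral_separated_circles:
  assumes "u holomorphic_on U" "\<forall>c\<in>C. cball c r \<subseteq> U"
    and sep: "pairwise (\<lambda>c c'. 2 * r \<le> dist c c') C"
    and "a \<in> C" "w \<in> ball a r" "c \<in> C"
  shows "w \<notin> sphere c r"
    and "((\<lambda>\<zeta>. u \<zeta> / (\<zeta> - w)) has_contour_integral (if c = a then 2 * pi * \<i> * u w else 0))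
      (circlepath c r)"
proof -
  have r: "r > 0" using assms(5) by (metis ball_empty empty_iff not_le)
  have far: "w \<notin> cball c r" if "c \<noteq> a"
    using pairwiseD[OF sep assms(6,4) that] assms(5) dist_triangle[of c a w] by (simp add: dist_commute)
  then show "w \<notin> sphere c r" using assms(5) by (cases "c = a") auto
  have u: "u holomorphic_on cball c r"
    using assms(1,2,6) holomorphic_on_subset by blast
  show "((\<lambda>\<zeta>. u \<zeta> / (\<zeta> - w)) has_contour_integral (if c = a then 2 * pi * \<i> * u w else 0))
      (circlepath c r)"
  proof (cases "c = a")
    case True
    then show ?thesis
      using Cauchy_integral_circlepath_simple[OF u, of w] assms(5)
      by (simp add: dist_norm norm_minus_commute)
  next
    case False
    have "((\<lambda>\<zeta>. u \<zeta> / (\<zeta> - w)) has_contour_integral 0) (circlepath c r)"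
    proof (rule Cauchy_theorem_convex_simple)
      show "(\<lambda>\<zeta>. u \<zeta> / (\<zeta> - w)) holomorphic_on cball c r"
        using far[OF False] by (intro holomorphic_intros u) auto
    qed (use r in auto)
    with False show ?thesis by simp
  qed
qed

text \<open>The sum and the difference of the kernels at the two conjugate points have the denominator
  \<open>(w - \<zeta>)(cnj w - \<zeta>)\<close>. The difference carries the factor \<open>\<beta>\<close> that cancels the denominator of
  \<open>v\<^sub>i / \<beta>\<close>.\<close>

lemma slice_Cauchy_kernel:
  assumes "\<zeta> \<noteq> slice_coord q" "\<zeta> \<noteq> cnj (slice_coord q)"
  shows "1 / (\<zeta> - slice_coord q) + 1 / (\<zeta> - cnj (slice_coord q)) =
      - 2 * (offset 1 \<zeta> q * inverse (offset_square \<zeta> q))"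
    and "1 / (\<zeta> - slice_coord q) - 1 / (\<zeta> - cnj (slice_coord q)) =
      2 * \<i> * of_real (Im (slice_coord q)) * inverse (offset_square \<zeta> q)"
proof -
  define w where "w = slice_coord q"
  have y: "2 * offset 1 \<zeta> q = w + cnj w - 2 * \<zeta>"
    by (simp add: offset_def w_def slice_coord_def complex_add_cnj one_quat_def inner_quat_def)
  have nz: "\<zeta> - w \<noteq> 0" "\<zeta> - cnj w \<noteq> 0" "w - \<zeta> \<noteq> 0" "cnj w - \<zeta> \<noteq> 0"
    using assms by (auto simp: w_def)
  have "1 / (\<zeta> - w) + 1 / (\<zeta> - cnj w) = - (w + cnj w - 2 * \<zeta>) * inverse ((w - \<zeta>) * (cnj w - \<zeta>))"
    using nz by (simp add: divide_simps) (simp add: algebra_simps)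
  also have "\<dots> = - (2 * offset 1 \<zeta> q) * inverse (offset_square \<zeta> q)"
    by (simp only: y offset_square_slice_coord w_def)
  finally show "1 / (\<zeta> - slice_coord q) + 1 / (\<zeta> - cnj (slice_coord q)) =
      - 2 * (offset 1 \<zeta> q * inverse (offset_square \<zeta> q))"
    by (simp add: w_def mult.assoc)
  have "1 / (\<zeta> - w) - 1 / (\<zeta> - cnj w) = (w - cnj w) * inverse ((w - \<zeta>) * (cnj w - \<zeta>))"
    using nz by (simp add: divide_simps) (simp add: algebra_simps)
  then show "1 / (\<zeta> - slice_coord q) - 1 / (\<zeta> - cnj (slice_coord q)) =
      2 * \<i> * of_real (Im (slice_coord q)) * inverse (offset_square \<zeta> q)"
    unfolding offset_square_slice_coord w_def by (simp add: complex_diff_cnj mult_ac)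
qed

definition slice_Cauchy_integral ::
    "(complex \<Rightarrow> complex) \<Rightarrow> complex set \<Rightarrow> real \<Rightarrow> quat \<Rightarrow> quat \<Rightarrow> complex"
  where "slice_Cauchy_integral u C r i q = (\<Sum>c\<in>C. contour_integral (circlepath c r)
    (\<lambda>\<zeta>. u \<zeta> / (2 * pi * \<i>) * (offset i \<zeta> q * inverse (offset_square \<zeta> q))))"

text \<open>The second part remains true on the real axis with the convention \<open>x / 0 = 0\<close>, because then
  \<open>q \<bullet> i = 0\<close> and both sides vanish.\<close>

lemma slice_Cauchy_integral_formula:
  assumes "finite C" "u holomorphic_on U" "\<forall>c\<in>C. cball c r \<subseteq> U"
    and sep: "pairwise (\<lambda>c c'. 2 * r \<le> dist c c') C"
    and ab: "a \<in> C" "slice_coord q \<in> ball a r" "b \<in> C" "cnj (slice_coord q) \<in> ball b r"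
    and sym: "u (cnj (slice_coord q)) = cnj (u (slice_coord q))"
  shows "slice_Cauchy_integral u C r 1 q = - of_real (Re (u (slice_coord q)))"
    and "i \<in> Basis \<Longrightarrow> i \<noteq> 1 \<Longrightarrow> slice_Cauchy_integral u C r i q =
      of_real ((q \<bullet> i) * (Im (u (slice_coord q)) / Im (slice_coord q)))"
proof -
  define w where "w = slice_coord q"
  note cauchy = Cauchy_integral_separated_circles[OF assms(2,3) sep]
  have path: "\<zeta> \<noteq> w \<and> \<zeta> \<noteq> cnj w" if "c \<in> C" "\<zeta> \<in> path_image (circlepath c r)" for c \<zeta>
  proof -
    have "r \<ge> 0" using ab(2) by (metis ball_empty empty_iff not_le order.strict_implies_order)
    then show ?thesis
      using cauchy(1)[OF ab(1,2) that(1)] cauchy(1)[OF ab(3,4) that(1)] that(2)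
      by (auto simp: w_def)
  qed
  define W where "W = (\<lambda>c. if c = a then 2 * pi * \<i> * u w else 0)"
  define W' where "W' = (\<lambda>c. if c = b then 2 * pi * \<i> * u (cnj w) else 0)"
  have W: "((\<lambda>\<zeta>. u \<zeta> / (\<zeta> - w)) has_contour_integral W c) (circlepath c r)" if "c \<in> C" for c
    unfolding W_def w_def by (rule cauchy(2)[OF ab(1,2) that])
  have W': "((\<lambda>\<zeta>. u \<zeta> / (\<zeta> - cnj w)) has_contour_integral W' c) (circlepath c r)" if "c \<in> C" for c
    unfolding W'_def w_def by (rule cauchy(2)[OF ab(3,4) that])
  have sums: "(\<Sum>c\<in>C. W c) = 2 * pi * \<i> * u w" "(\<Sum>c\<in>C. W' c) = 2 * pi * \<i> * cnj (u w)"
    using ab(1,3) assms(1) sym by (simp_all add: W_def W'_def w_def)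

  \<comment> \<open>Cauchy's constant divided by \<open>- 2\<close>, the factor in the sum of the two kernels\<close>
  define h :: complex where "h = - 1 / (4 * pi * \<i>)"
  have "contour_integral (circlepath c r)
      (\<lambda>\<zeta>. u \<zeta> / (2 * pi * \<i>) * (offset 1 \<zeta> q * inverse (offset_square \<zeta> q))) =
      h * (W c + W' c)" if c: "c \<in> C" for c
  proof (rule contour_integral_unique, rule has_contour_integral_eq)
    show "((\<lambda>\<zeta>. h * (u \<zeta> / (\<zeta> - w) + u \<zeta> / (\<zeta> - cnj w)))
        has_contour_integral h * (W c + W' c)) (circlepath c r)"
      by (intro has_contour_integral_lmul has_contour_integral_add W W' c)
    fix \<zeta> assume "\<zeta> \<in> path_image (circlepath c r)"
    then have "1 / (\<zeta> - w) + 1 / (\<zeta> - cnj w) =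
        - 2 * (offset 1 \<zeta> q * inverse (offset_square \<zeta> q))"
      unfolding w_def by (intro slice_Cauchy_kernel(1)) (use path[OF c] in \<open>auto simp: w_def\<close>)
    moreover have "u \<zeta> / (\<zeta> - w) + u \<zeta> / (\<zeta> - cnj w) = u \<zeta> * (1 / (\<zeta> - w) + 1 / (\<zeta> - cnj w))"
      by (simp add: algebra_simps)
    ultimately show "h * (u \<zeta> / (\<zeta> - w) + u \<zeta> / (\<zeta> - cnj w)) =
        u \<zeta> / (2 * pi * \<i>) * (offset 1 \<zeta> q * inverse (offset_square \<zeta> q))"
      by (simp add: h_def mult_ac)
  qed
  then have "slice_Cauchy_integral u C r 1 q = h * ((\<Sum>c\<in>C. W c) + (\<Sum>c\<in>C. W' c))"
    by (simp add: slice_Cauchy_integral_def sum_distrib_left[symmetric] sum.distrib)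
  also have "\<dots> = - (u w + cnj (u w)) / 2"
    unfolding sums by (simp add: h_def field_simps)
  finally show "slice_Cauchy_integral u C r 1 q = - of_real (Re (u (slice_coord q)))"
    by (simp add: complex_add_cnj w_def)

  assume i: "i \<in> Basis" "i \<noteq> 1"
  have off: "offset i \<zeta> q = of_real (q \<bullet> i)" for \<zeta>
    using i by (simp add: offset_def)
  show "slice_Cauchy_integral u C r i q =
      of_real ((q \<bullet> i) * (Im (u (slice_coord q)) / Im (slice_coord q)))"
  proof (cases "Im w = 0")
    case True
    then have "q \<bullet> i = 0"
      using i by (auto simp: w_def slice_coord_def Basis_quat_def one_quat_def inner_quat_def
          add_nonneg_eq_0_iff)
    then show ?thesis
      by (simp add: slice_Cauchy_integral_def off)
  next
    case False
    define k :: complex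
      where "k = of_real (q \<bullet> i) / (2 * pi * \<i>) / (2 * \<i> * of_real (Im w))"
    have k: "k * (2 * \<i> * of_real (Im w)) = of_real (q \<bullet> i) / (2 * pi * \<i>)"
      by (rule nonzero_eq_divide_eq[THEN iffD1, OF _ k_def]) (use False in simp)
    have "contour_integral (circlepath c r)
        (\<lambda>\<zeta>. u \<zeta> / (2 * pi * \<i>) * (offset i \<zeta> q * inverse (offset_square \<zeta> q))) =
        k * (W c - W' c)" if c: "c \<in> C" for c
    proof (rule contour_integral_unique, rule has_contour_integral_eq)
      show "((\<lambda>\<zeta>. k * (u \<zeta> / (\<zeta> - w) - u \<zeta> / (\<zeta> - cnj w)))
          has_contour_integral k * (W c - W' c)) (circlepath c r)"
        by (intro has_contour_integral_lmul has_contour_integral_diff W W' c)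
      fix \<zeta> assume "\<zeta> \<in> path_image (circlepath c r)"
      then have "1 / (\<zeta> - w) - 1 / (\<zeta> - cnj w) =
          2 * \<i> * of_real (Im w) * inverse (offset_square \<zeta> q)"
        unfolding w_def by (intro slice_Cauchy_kernel(2)) (use path[OF c] in \<open>auto simp: w_def\<close>)
      moreover have "u \<zeta> / (\<zeta> - w) - u \<zeta> / (\<zeta> - cnj w) = u \<zeta> * (1 / (\<zeta> - w) - 1 / (\<zeta> - cnj w))"
        by (simp add: algebra_simps)
      ultimately have "k * (u \<zeta> / (\<zeta> - w) - u \<zeta> / (\<zeta> - cnj w)) =
          u \<zeta> * (k * (2 * \<i> * of_real (Im w))) * inverse (offset_square \<zeta> q)"
        by (simp only: mult_ac)
      then show "k * (u \<zeta> / (\<zeta> - w) - u \<zeta> / (\<zeta> - cnj w)) =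
          u \<zeta> / (2 * pi * \<i>) * (offset i \<zeta> q * inverse (offset_square \<zeta> q))"
        unfolding k off by simp
    qed
    then have "slice_Cauchy_integral u C r i q = k * ((\<Sum>c\<in>C. W c) - (\<Sum>c\<in>C. W' c))"
      by (simp add: slice_Cauchy_integral_def sum_distrib_left[symmetric] sum_subtractf)
    also have "\<dots> = k * (2 * pi * \<i> * (u w - cnj (u w)))"
      unfolding sums by (simp add: algebra_simps)
    also have "\<dots> = of_real ((q \<bullet> i) * (Im (u w) / Im w))"
      using False by (simp add: k_def complex_diff_cnj field_simps)
    finally show ?thesis by (simp add: w_def)
  qed
qed

lemma biharmonic_on_slice_Cauchy_integral:
  assumes "continuous_on (\<Union>c\<in>C. sphere c r) u" "r > 0" "i \<in> Basis" "open S"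
    and off: "\<And>c q. c \<in> C \<Longrightarrow> q \<in> S \<Longrightarrow> slice_coord q \<notin> sphere c r"
      "\<And>c q. c \<in> C \<Longrightarrow> q \<in> S \<Longrightarrow> cnj (slice_coord q) \<notin> sphere c r"
  shows "biharmonic_on (slice_Cauchy_integral u C r i) S"
proof -
  have "biharmonic_on (\<lambda>q. contour_integral (circlepath c r)
      (\<lambda>\<zeta>. u \<zeta> / (2 * pi * \<i>) * (offset i \<zeta> q * inverse (offset_square \<zeta> q)))) S" if c: "c \<in> C" for c
  proof -
    define \<phi> where "\<phi> = (\<lambda>t. u (circlepath c r t) / (2 * pi * \<i>) *
      vector_derivative (circlepath c r) (at t))"
    have circ: "circlepath c r t \<in> sphere c r" if "t \<in> {0..1}" for t
      using path_image_circlepath[of c r] assms(2) that unfolding path_image_def by auto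
    have cont: "continuous_on {0..1} (circlepath c r)"
      using path_circlepath[of c r] by (simp add: path_def)
    have "biharmonic_on (\<lambda>q. integral {0..1} (\<lambda>t. \<phi> t *
        (offset i (circlepath c r t) q * inverse (offset_square (circlepath c r t) q)))) S"
    proof (rule biharmonic_on_cauchy_kernel_integral[OF cont _ assms(3,4)])
      show "continuous_on {0..1} \<phi>"
        unfolding \<phi>_def vector_derivative_circlepath
        using circ c
        by (intro continuous_intros continuous_on_compose2[OF assms(1) cont]) auto
      fix t :: real and q assume t: "t \<in> {0..1}" "q \<in> S"
      show "offset_square (circlepath c r t) q \<noteq> 0"
        using circ[OF t(1)] off[OF c t(2)] by (auto simp: offset_square_slice_coord)
    qed
    then show ?thesis
      by (simp add: contour_integral_integral \<phi>_def mult_ac)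
  qed
  then show ?thesis
    unfolding slice_Cauchy_integral_def[abs_def] by (rule biharmonic_on_sum[OF assms(4)])
qed

text \<open>Locally \<open>u\<close> is given by Cauchy integrals over circles around \<open>w\<^sub>0\<close> and its conjugate, which
  coincide when \<open>w\<^sub>0\<close> is real; this is how the real axis is treated on the same footing as the other
  points.\<close>

lemma biharmonic_on_slice_coord:
  assumes "open U" and cnj: "\<And>w. w \<in> U \<Longrightarrow> cnj w \<in> U"
    and u: "u holomorphic_on U" "\<And>w. w \<in> U \<Longrightarrow> u (cnj w) = cnj (u w)"
  shows "biharmonic_on (\<lambda>q. Re (u (slice_coord q))) {q. slice_coord q \<in> U}"
    and "i \<in> Basis \<Longrightarrow> i \<noteq> 1 \<Longrightarrow>
      biharmonic_on (\<lambda>q. (q \<bullet> i) * (Im (u (slice_coord q)) / Im (slice_coord q)))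
        {q. slice_coord q \<in> U}"
proof -
  have local: "\<exists>S C r. open S \<and> q0 \<in> S \<and>
      (\<forall>i\<in>Basis. biharmonic_on (\<lambda>q. Re (slice_Cauchy_integral u C r i q)) S) \<and>
      (\<forall>q\<in>S. slice_Cauchy_integral u C r 1 q = - of_real (Re (u (slice_coord q)))) \<and>
      (\<forall>i\<in>Basis - {1}. \<forall>q\<in>S. slice_Cauchy_integral u C r i q =
        of_real ((q \<bullet> i) * (Im (u (slice_coord q)) / Im (slice_coord q))))"
    if q0: "slice_coord q0 \<in> U" for q0
  proof -
    define w0 where "w0 = slice_coord q0"
    obtain e1 where e1: "e1 > 0" "cball w0 e1 \<subseteq> U"
      using assms(1) q0 unfolding w0_def open_contains_cball by blast
    obtain e2 where e2: "e2 > 0" "cball (cnj w0) e2 \<subseteq> U"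
      using assms(1) cnj[OF q0] unfolding w0_def open_contains_cball by blast
    \<comment> \<open>off the real axis the centres have distance \<open>2 |Im w0|\<close>, which must be at least \<open>2 r\<close>\<close>
    define r where "r = (if Im w0 = 0 then min e1 e2 else min (min e1 e2) \<bar>Im w0\<bar>)"
    define C where "C = {w0, cnj w0}"
    define S where "S = {q. slice_coord q \<in> ball w0 r}"
    have r: "r > 0" using e1 e2 by (simp add: r_def)
    have sub: "\<forall>c\<in>C. cball c r \<subseteq> U"
      using e1 e2 by (force simp: C_def r_def split: if_splits)
    have "dist w0 (cnj w0) = 2 * \<bar>Im w0\<bar>"
      by (simp add: dist_norm complex_diff_cnj norm_mult)
    then have sep: "pairwise (\<lambda>c c'. 2 * r \<le> dist c c') C"
      by (auto simp: C_def r_def pairwise_def dist_commute complex_eq_iff)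
    have "open S"
      unfolding S_def using continuous_open_preimage[OF continuous_on_slice_coord open_UNIV open_ball]
      by (simp add: vimage_def)
    have S: "slice_coord q \<in> ball w0 r" "cnj (slice_coord q) \<in> ball (cnj w0) r" "slice_coord q \<in> U"
      if "q \<in> S" for q
    proof -
      show q: "slice_coord q \<in> ball w0 r" using that by (simp add: S_def)
      then show "cnj (slice_coord q) \<in> ball (cnj w0) r"
        by (simp add: dist_norm flip: complex_cnj_diff)
      show "slice_coord q \<in> U" using q sub by (auto simp: C_def)
    qed
    have C: "finite C" "w0 \<in> C" "cnj w0 \<in> C" by (simp_all add: C_def)
    note cauchy = Cauchy_integral_separated_circles(1)[OF u(1) sub sep]
    have "biharmonic_on (slice_Cauchy_integral u C r i) S" if "i \<in> Basis" for i
    proof (rule biharmonic_on_slice_Cauchy_integral[OF _ r that \<open>open S\<close>])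
      show "continuous_on (\<Union>c\<in>C. sphere c r) u"
        using sub by (intro continuous_on_subset[OF holomorphic_on_imp_continuous_on[OF u(1)]]) force
      show "slice_coord q \<notin> sphere c r" if "c \<in> C" "q \<in> S" for c q
        using cauchy[OF C(2) S(1) that(1)] that by blast
      show "cnj (slice_coord q) \<notin> sphere c r" if "c \<in> C" "q \<in> S" for c q
        using cauchy[OF C(3) S(2) that(1)] that by blast
    qed
    then have "\<forall>i\<in>Basis. biharmonic_on (\<lambda>q. Re (slice_Cauchy_integral u C r i q)) S"
      using biharmonic_on_bounded_linear[OF \<open>open S\<close> bounded_linear_Re] by blast
    moreover have "q0 \<in> S" using r by (simp add: S_def w0_def)
    ultimately show ?thesis
      using \<open>open S\<close> slice_Cauchy_integral_formula[OF C(1) u(1) sub sep C(2) S(1) C(3) S(2)] u(2)[OF S(3)]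
      by (intro exI[of _ S] exI[of _ C] exI[of _ r]) auto
  qed
  have one: "(1 :: quat) \<in> Basis" by (simp add: Basis_quat_def one_quat_def)
  show "biharmonic_on (\<lambda>q. Re (u (slice_coord q))) {q. slice_coord q \<in> U}"
  proof (rule biharmonic_on_locally, goal_cases)
    case (1 q0)
    then obtain S C r where S: "open S" "q0 \<in> S"
      and bih: "biharmonic_on (\<lambda>q. Re (slice_Cauchy_integral u C r 1 q)) S"
      and eq: "\<And>q. q \<in> S \<Longrightarrow> slice_Cauchy_integral u C r 1 q = - of_real (Re (u (slice_coord q)))"
      using local[of q0] one by blast
    have "biharmonic_on (\<lambda>q. - Re (slice_Cauchy_integral u C r 1 q)) S"
      by (rule biharmonic_on_bounded_linear[OF S(1) _ bih]) (intro bounded_linear_minus bounded_linear_ident)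
    then have "biharmonic_on (\<lambda>q. Re (u (slice_coord q))) S"
      by (rule biharmonic_on_cong[OF S(1), rotated]) (simp add: eq)
    with S show ?case by blast
  qed
  assume i: "i \<in> Basis" "i \<noteq> 1"
  show "biharmonic_on (\<lambda>q. (q \<bullet> i) * (Im (u (slice_coord q)) / Im (slice_coord q)))
      {q. slice_coord q \<in> U}"
  proof (rule biharmonic_on_locally, goal_cases)
    case (1 q0)
    then obtain S C r where S: "open S" "q0 \<in> S"
      and bih: "biharmonic_on (\<lambda>q. Re (slice_Cauchy_integral u C r i q)) S"
      and eq: "\<And>q. q \<in> S \<Longrightarrow> slice_Cauchy_integral u C r i q =
        of_real ((q \<bullet> i) * (Im (u (slice_coord q)) / Im (slice_coord q)))"
      using local[of q0] i by blast
    have "biharmonic_on (\<lambda>q. (q \<bullet> i) * (Im (u (slice_coord q)) / Im (slice_coord q))) S"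
      by (rule biharmonic_on_cong[OF S(1) _ bih]) (simp add: eq)
    with S show ?case by blast
  qed
qed

section \<open>Stem functions in one variable\<close>

text \<open>Continuity of the partial derivative along the imaginary axis makes the two partial derivatives
  combine to a total derivative; the Cauchy-Riemann equation then makes it complex-linear.\<close>

lemma holomorphic_on_Cauchy_Riemann:
  assumes "open U" "continuous_on U uy"
    and ux: "\<And>w. w \<in> U \<Longrightarrow> ((\<lambda>t. u (w + t *\<^sub>R 1)) has_vector_derivative ux w) (at 0)"
    and uy: "\<And>w. w \<in> U \<Longrightarrow> ((\<lambda>t. u (w + t *\<^sub>R \<i>)) has_vector_derivative uy w) (at 0)"
    and CR: "\<And>w. w \<in> U \<Longrightarrow> uy w = \<i> * ux w"
  shows "u holomorphic_on U"
  unfolding holomorphic_on_open[OF assms(1)]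
proof
  fix w assume w: "w \<in> U"
  define x y where "x = Re w" and "y = Im w"
  obtain e where e: "e > 0" "ball w e \<subseteq> U"
    using assms(1) w openE by blast
  define X Y where "X = ball x (e / 2)" and "Y = ball y (e / 2)"
  have sub: "Complex s t \<in> U" if "s \<in> X" "t \<in> Y" for s t
  proof -
    have "cmod (w - Complex s t) \<le> \<bar>x - s\<bar> + \<bar>y - t\<bar>"
      using cmod_le[of "w - Complex s t"] by (simp add: x_def y_def)
    also have "\<dots> < e" using that by (simp add: X_def Y_def dist_norm)
    finally show ?thesis using e by (auto simp: dist_norm)
  qed
  have shift: "((\<lambda>s. h (a + s *\<^sub>R v)) has_vector_derivative d) (at 0) \<Longrightarrow>
      ((\<lambda>s. h (a + (s - s0) *\<^sub>R v)) has_derivative (\<lambda>s. s *\<^sub>R d)) (at s0 within T)"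
    for h :: "complex \<Rightarrow> complex" and a v d s0 T
  proof -
    assume *: "((\<lambda>s. h (a + s *\<^sub>R v)) has_vector_derivative d) (at 0)"
    have "((\<lambda>s. s - s0) has_vector_derivative 1) (at s0)"
      by (auto intro!: derivative_eq_intros)
    moreover have "((\<lambda>s. h (a + s *\<^sub>R v)) has_vector_derivative d) (at (s0 - s0))"
      using * by simp
    ultimately have "((\<lambda>s. h (a + s *\<^sub>R v)) \<circ> (\<lambda>s. s - s0) has_vector_derivative 1 *\<^sub>R d) (at s0)"
      by (rule vector_diff_chain_at)
    then show ?thesis
      unfolding has_vector_derivative_def o_def by (simp add: has_derivative_at_withinI)
  qed
  have "((\<lambda>(s, t). u (Complex s t)) has_derivative
      (\<lambda>(s, t). s *\<^sub>R ux w + blinfun_scaleR_left (uy (Complex x y)) t)) (at (x, y) within X \<times> Y)"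
  proof (rule has_derivative_partialsI)
    have "(\<lambda>s. u (w + (s - x) *\<^sub>R 1)) = (\<lambda>s. u (Complex s y))"
      by (rule ext, rule arg_cong[of _ _ u]) (simp add: complex_eq_iff x_def y_def)
    with shift[OF ux[OF w], of x X]
    show "((\<lambda>s. u (Complex s y)) has_derivative (\<lambda>s. s *\<^sub>R ux w)) (at x within X)"
      by simp
    fix s t assume st: "s \<in> X" "t \<in> Y"
    have "(\<lambda>r. u (Complex s t + (r - t) *\<^sub>R \<i>)) = (\<lambda>r. u (Complex s r))"
      by (rule ext, rule arg_cong[of _ _ u]) (simp add: complex_eq_iff)
    with shift[OF uy[OF sub[OF st]], of t Y]
    show "((\<lambda>t. u (Complex s t)) has_derivative blinfun_scaleR_left (uy (Complex s t))) (at t within Y)"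
      by simp
  next
    have "continuous_on (X \<times> Y) (\<lambda>p. blinfun_scaleR_left (uy (Complex (fst p) (snd p))))"
      unfolding Complex_eq
      by (intro bounded_linear.continuous_on[OF bounded_linear_blinfun_scaleR_left]
          continuous_on_compose2[OF assms(2)] continuous_intros)
        (use sub in \<open>auto simp: Complex_eq\<close>)
    moreover have "(x, y) \<in> X \<times> Y" using e by (simp add: X_def Y_def)
    ultimately show "continuous (at (x, y) within X \<times> Y) (\<lambda>(s, t). blinfun_scaleR_left (uy (Complex s t)))"
      by (simp add: continuous_on_eq_continuous_within case_prod_unfold)
  qed (use e in \<open>auto simp: Y_def\<close>)
  moreover have "at (x, y) within X \<times> Y = at (x, y)"
    using e by (intro at_within_open open_Times) (auto simp: X_def Y_def)
  ultimately have "((\<lambda>(s, t). u (Complex s t)) has_derivative (\<lambda>(s, t). s *\<^sub>R ux w + t *\<^sub>R uy w))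
      (at (Re w, Im w))"
    by (simp add: x_def y_def)
  note total = this
  have "((\<lambda>w. (Re w, Im w)) has_derivative (\<lambda>h. (Re h, Im h))) (at w)"
    by (intro derivative_intros)
  from has_derivative_compose[OF this total]
  have "(u has_derivative (\<lambda>h. Re h *\<^sub>R ux w + Im h *\<^sub>R uy w)) (at w)"
    by simp
  moreover have "(\<lambda>h. Re h *\<^sub>R ux w + Im h *\<^sub>R uy w) = (*) (ux w)"
    by (simp add: fun_eq_iff CR[OF w] complex_eq_iff algebra_simps)
  ultimately show "\<exists>f'. (u has_field_derivative f') (at w)"
    by (auto simp: has_field_derivative_def)
qed

lemma stem_J_nth:
  "stem_J h w $ K = (- 1) ^ card (sym_diff K {h} \<inter> {h}) * w $ (sym_diff K {h})"
proof -
  have "stem_J h w $ K = (\<Sum>L\<in>UNIV. if L = sym_diff K {h} then (- 1) ^ card (L \<inter> {h}) * w $ L else 0)"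
    unfolding stem_J_def sum_component
  proof (rule sum.cong)
    fix L :: "'a set"
    have "K = sym_diff L {h} \<longleftrightarrow> L = sym_diff K {h}" by auto
    then show "axis (sym_diff L {h}) ((- 1) ^ card (L \<inter> {h}) * w $ L) $ K =
        (if L = sym_diff K {h} then (- 1) ^ card (L \<inter> {h}) * w $ L else 0)"
      unfolding axis_def by simp
  qed simp
  then show ?thesis by simp
qed

lemma replace_at_line: "replace_at z m w + t *\<^sub>R axis m v = replace_at z m (w + t *\<^sub>R v)"
  by (simp add: vec_eq_iff replace_at_def axis_def)

lemma replace_at_replace_at: "replace_at (replace_at z m v) m w = replace_at z m w"
  by (simp add: vec_eq_iff replace_at_def)

lemma replace_at_nth_same: "replace_at z m w $ m = w"
  by (simp add: replace_at_def)

lemma continuous_on_replace_at: "continuous_on S (\<lambda>w. replace_at z m w)"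
  unfolding replace_at_def
proof (rule continuous_on_vec_lambda)
  show "continuous_on S (\<lambda>w. if h = m then w else z $ h)" for h
    by (cases "h = m") (auto intro: continuous_intros)
qed

text \<open>The coefficients of \<open>K\<close> without \<open>m\<close> and of \<open>K\<close> with \<open>m\<close> are interchanged by \<open>\<J>\<^sub>m\<close> up to
  sign. They are paired, in one real coordinate \<open>e\<close>, as real and imaginary part, so that \<open>\<J>\<^sub>m\<close> acts
  as multiplication by \<open>\<i>\<close>. The sets \<open>K\<close> and \<open>K \<union> {m}\<close> give the same function.\<close>

definition stem_section ::
    "(complex^'n::finite \<Rightarrow> quat^('n set)) \<Rightarrow> complex^'n \<Rightarrow> 'n \<Rightarrow> 'n set \<Rightarrow> quat \<Rightarrow> complex \<Rightarrow> complex"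
  where "stem_section F z m K e w =
    Complex (F (replace_at z m w) $ (K - {m}) \<bullet> e) (F (replace_at z m w) $ (insert m K) \<bullet> e)"

text \<open>The components at \<open>K - {m}\<close> and at \<open>insert m K\<close> of the equation \<open>stem_dbar m F = 0\<close> are
  the two Cauchy-Riemann equations.\<close>

lemma stem_section_holomorphic:
  assumes "open D" "holomorphic_stem_on D F"
  shows "stem_section F z m K e holomorphic_on {w. replace_at z m w \<in> D}"
proof (rule holomorphic_on_Cauchy_Riemann)
  let ?r = "replace_at z m"
  define L where "L = (\<lambda>V. Complex ((V::quat^('a set)) $ (K - {m}) \<bullet> e) (V $ (insert m K) \<bullet> e))"
  have L: "bounded_linear L"
    unfolding L_def Complex_eq
    by (intro bounded_linear_add bounded_linear_const_mult bounded_linear_of_real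
        bounded_linear_compose[OF bounded_linear_of_real]
        bounded_linear_compose[OF bounded_linear_inner_left bounded_linear_vec_nth])
  have C1: "Ck_on (Suc 0) F D" and dbar: "\<And>z. z \<in> D \<Longrightarrow> stem_dbar m F z = 0"
    using assms(2) by (simp_all add: holomorphic_stem_on_def)
  have basis: "axis m 1 \<in> (Basis :: (complex^'a) set)" "axis m \<i> \<in> (Basis :: (complex^'a) set)"
    by (simp_all add: axis_in_Basis_iff Basis_complex_def)
  define Fx Fy where "Fx = dir_deriv (axis m 1) F" and "Fy = dir_deriv (axis m \<i>) F"
  show "open {w. ?r w \<in> D}"
    using continuous_open_preimage[OF continuous_on_replace_at open_UNIV assms(1), of z m]
    by (simp add: vimage_def)
  have "continuous_on D Fy"
    using Ck_on_SucD(1)[OF C1 basis(2)] by (simp add: Fy_def)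
  then show "continuous_on {w. ?r w \<in> D} (\<lambda>w. L (Fy (?r w)))"
    by (intro bounded_linear.continuous_on[OF L] continuous_on_compose2[OF _ continuous_on_replace_at])
      auto
  fix w assume "w \<in> {w. ?r w \<in> D}"
  then have w: "?r w \<in> D" by simp
  have eq_L: "stem_section F z m K e v = L (F (?r v))" for v
    by (simp add: stem_section_def L_def)
  show "((\<lambda>t. stem_section F z m K e (w + t *\<^sub>R 1)) has_vector_derivative L (Fx (?r w))) (at 0)"
    using bounded_linear.has_vector_derivative[OF L Ck_on_SucD(2)[OF C1 basis(1) w]]
    by (simp add: eq_L replace_at_line Fx_def)
  show "((\<lambda>t. stem_section F z m K e (w + t *\<^sub>R \<i>)) has_vector_derivative L (Fy (?r w))) (at 0)"
    using bounded_linear.has_vector_derivative[OF L Ck_on_SucD(2)[OF C1 basis(2) w]]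
    by (simp add: eq_L replace_at_line Fy_def)
  have "Fx (?r w) $ I + stem_J m (Fy (?r w)) $ I = 0" for I
    using dbar[OF w] by (simp add: stem_dbar_def Fx_def Fy_def vec_eq_iff)
  then have eq: "Fx (?r w) $ I = - stem_J m (Fy (?r w)) $ I" for I
    by (simp add: eq_neg_iff_add_eq_0)
  have sets: "sym_diff (K - {m}) {m} = insert m K" "sym_diff (insert m K) {m} = K - {m}"
    "insert m K \<inter> {m} = {m}" "(K - {m}) \<inter> {m} = {}"
    by auto
  have "Fx (?r w) $ (K - {m}) = Fy (?r w) $ (insert m K)"
    unfolding eq stem_J_nth sets by simp
  moreover have "Fx (?r w) $ (insert m K) = - Fy (?r w) $ (K - {m})"
    unfolding eq stem_J_nth sets by simp
  ultimately show "L (Fy (?r w)) = \<i> * L (Fx (?r w))"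
    by (simp add: L_def complex_eq_iff)
qed

lemma stem_section_cnj:
  assumes "stem_function_on D F" "replace_at z m w \<in> D"
  shows "stem_section F z m K e (cnj w) = cnj (stem_section F z m K e w)"
proof -
  have "F (replace_at z m (cnj w)) $ I = (- 1) ^ card (I \<inter> {m}) * F (replace_at z m w) $ I" for I
    using assms unfolding stem_function_on_def
    by (metis replace_at_replace_at replace_at_nth_same)
  moreover have "insert m K \<inter> {m} = {m}" "(K - {m}) \<inter> {m} = {}" by auto
  ultimately show ?thesis
    by (simp add: stem_section_def complex_eq_iff)
qed

lemma ordered_prod_cong: "(\<And>h. h \<in> K \<Longrightarrow> p h = q h) \<Longrightarrow> ordered_prod p K = ordered_prod q K"
  unfolding ordered_prod_def by (intro arg_cong[of _ _ prod_list] map_cong) auto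

text \<open>The factor with index \<open>m\<close> occurs exactly once, between two products that do not depend on it.\<close>

lemma ordered_prod_linear:
  assumes "m \<in> K"
  shows "linear (\<lambda>I. ordered_prod (J(m := I)) K)"
proof -
  let ?xs = "sorted_list_of_set K"
  have "m \<in> set ?xs" using assms by simp
  then obtain ys zs where xs: "?xs = ys @ m # zs" by (meson split_list)
  have "distinct ?xs" by simp
  then have "m \<notin> set ys" "m \<notin> set zs" unfolding xs by auto
  then have "map (J(m := I)) ys = map J ys" "map (J(m := I)) zs = map J zs" for I
    by (auto intro: map_cong)
  then have "ordered_prod (J(m := I)) K = prod_list (map J ys) * I * prod_list (map J zs)" for I
    by (simp add: ordered_prod_def xs mult.assoc fun_upd_same del: fun_upd_apply map_eq_conv)
  then show ?thesis
    by (auto intro!: linearI simp: algebra_simps)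
qed

lemma imag_units_iff:
  "J \<in> imag_units \<longleftrightarrow> q_re J = 0 \<and> (q_i J)\<^sup>2 + (q_j J)\<^sup>2 + (q_k J)\<^sup>2 = 1"
proof
  assume "J \<in> imag_units"
  then have "J * J = - 1" by (simp add: imag_units_def power2_eq_square)
  then have J: "q_re J * q_re J - q_i J * q_i J - q_j J * q_j J - q_k J * q_k J = - 1"
    "q_re J * q_i J = 0" "q_re J * q_j J = 0" "q_re J * q_k J = 0"
    by (simp_all add: quat_eq_iff mult.commute)
  have "q_re J = 0"
  proof (rule ccontr)
    assume "q_re J \<noteq> 0"
    with J have "q_re J * q_re J = - 1" by simp
    then show False using zero_le_square[of "q_re J"] by linarith
  qed
  with J(1) show "q_re J = 0 \<and> (q_i J)\<^sup>2 + (q_j J)\<^sup>2 + (q_k J)\<^sup>2 = 1"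
    by (simp add: power2_eq_square)
next
  assume "q_re J = 0 \<and> (q_i J)\<^sup>2 + (q_j J)\<^sup>2 + (q_k J)\<^sup>2 = 1"
  then show "J \<in> imag_units"
    by (simp add: imag_units_def quat_eq_iff power2_eq_square)
qed

lemma of_real_quat: "of_real r = Quat r 0 0 0"
  by (simp add: of_real_def quat_eq_iff)

lemma slice_coord_slice:
  assumes "J \<in> imag_units"
  shows "slice_coord (of_real a + J * of_real b) = Complex a \<bar>b\<bar>"
proof -
  have "(q_i J * b)\<^sup>2 + (q_j J * b)\<^sup>2 + (q_k J * b)\<^sup>2 = b\<^sup>2 * ((q_i J)\<^sup>2 + (q_j J)\<^sup>2 + (q_k J)\<^sup>2)"
    by (simp add: algebra_simps power_mult_distrib)
  with assms show ?thesis
    by (simp add: slice_coord_def of_real_quat imag_units_iff)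
qed

lemma slice_coord_obtain_unit:
  obtains I where "I \<in> imag_units"
    "q = of_real (Re (slice_coord q)) + I * of_real (Im (slice_coord q))"
proof -
  define b where "b = Im (slice_coord q)"
  have b: "(q_i q)\<^sup>2 + (q_j q)\<^sup>2 + (q_k q)\<^sup>2 = b\<^sup>2"
    by (simp add: b_def slice_coord_def)
  show ?thesis
  proof (cases "b = 0")
    case True
    then show ?thesis
      using b by (intro that[of "Quat 0 1 0 0"])
        (auto simp: imag_units_iff quat_eq_iff of_real_quat slice_coord_def add_nonneg_eq_0_iff)
  next
    case False
    have "(q_i q / b)\<^sup>2 + (q_j q / b)\<^sup>2 + (q_k q / b)\<^sup>2 = 1"
      using b False by (simp add: power_divide add_divide_distrib[symmetric])
    then show ?thesis
      using False by (intro that[of "Quat 0 (q_i q / b) (q_j q / b) (q_k q / b)"])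
        (auto simp: imag_units_iff quat_eq_iff of_real_quat b_def[symmetric], simp add: slice_coord_def)
  qed
qed

text \<open>The unit \<open>I\<close> of \<open>q = \<alpha> + v\<close> is \<open>v / |v|\<close>, so a linear expression in \<open>I\<close> has the coefficients
  \<open>v\<^sub>i / |v|\<close>. On the real axis \<open>I\<close> is arbitrary, and the hypothesis on \<open>r\<close> removes it.\<close>

lemma scaled_linear_on_unit:
  fixes L :: "quat \<Rightarrow> 'b::real_vector"
  assumes "linear L" "I \<in> imag_units"
    and q: "q = of_real (Re (slice_coord q)) + I * of_real (Im (slice_coord q))"
    and r: "Im (slice_coord q) = 0 \<Longrightarrow> r = 0"
  shows "r *\<^sub>R L I = (\<Sum>i\<in>Basis - {1}. ((q \<bullet> i) * (r / Im (slice_coord q))) *\<^sub>R L i)"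
proof (cases "Im (slice_coord q) = 0")
  case True
  then show ?thesis by (simp add: r)
next
  case False
  define b where "b = Im (slice_coord q)"
  have "q \<bullet> i = (I \<bullet> i) * b" if "i \<in> Basis - {1}" for i
    using that by (subst q) (auto simp: Basis_quat_def one_quat_def inner_quat_def of_real_quat b_def)
  then have "(\<Sum>i\<in>Basis - {1}. ((q \<bullet> i) * (r / b)) *\<^sub>R L i) = (\<Sum>i\<in>Basis - {1}. ((I \<bullet> i) * r) *\<^sub>R L i)"
    using False by (intro sum.cong) (auto simp: b_def)
  also have "\<dots> = (\<Sum>i\<in>Basis. ((I \<bullet> i) * r) *\<^sub>R L i)"
    using assms(2) by (intro sum.mono_neutral_left) (auto simp: imag_units_iff inner_quat_def one_quat_def)
  also have "\<dots> = r *\<^sub>R L (\<Sum>i\<in>Basis. (I \<bullet> i) *\<^sub>R i)"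
    using assms(1) by (simp add: linear_sum linear_cmul scaleR_sum_right mult.commute)
  finally show ?thesis by (simp add: b_def euclidean_representation)
qed

lemma slice_point_replace_at:
  "slice_point (replace_at z m w) (J(m := I)) =
    replace_at (slice_point z J) m (of_real (Re w) + I * of_real (Im w))"
  by (simp add: vec_eq_iff slice_point_def replace_at_def)

text \<open>The right-hand side does not mention the imaginary unit of \<open>q\<close>, which is ambiguous on the real
  axis: there the coefficients \<open>F\<^sub>K\<close> with \<open>m \<in> K\<close> vanish by parity.\<close>

lemma slice_function_one_variable:
  assumes "induced_by D F f" "stem_function_on D F" "\<And>h. J h \<in> imag_units"
    and w: "replace_at z m (slice_coord q) \<in> D"
  shows "f (replace_at (slice_point z J) m q) = (\<Sum>K\<in>UNIV. \<Sum>e\<in>Basis.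
    if m \<in> K then \<Sum>i\<in>Basis - {1}.
      ((q \<bullet> i) * (Im (stem_section F z m K e (slice_coord q)) / Im (slice_coord q))) *\<^sub>R
        (ordered_prod (J(m := i)) K * e)
    else Re (stem_section F z m K e (slice_coord q)) *\<^sub>R (ordered_prod J K * e))"
proof -
  define w where "w = slice_coord q"
  obtain I where I: "I \<in> imag_units" "q = of_real (Re w) + I * of_real (Im w)"
    unfolding w_def by (rule slice_coord_obtain_unit)
  define G where "G = F (replace_at z m w)"
  have "f (replace_at (slice_point z J) m q) = f (slice_point (replace_at z m w) (J(m := I)))"
    by (simp add: slice_point_replace_at I(2)[symmetric])
  also have "\<dots> = (\<Sum>K\<in>UNIV. ordered_prod (J(m := I)) K * G $ K)"
  proof -
    have "\<forall>h. (J(m := I)) h \<in> imag_units" using assms(3) I(1) by simp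
    then show ?thesis using assms(1) w unfolding induced_by_def G_def w_def by blast
  qed
  also have "\<dots> = (\<Sum>K\<in>UNIV. \<Sum>e\<in>Basis. (G $ K \<bullet> e) *\<^sub>R (ordered_prod (J(m := I)) K * e))"
  proof (rule sum.cong)
    fix K
    have "ordered_prod (J(m := I)) K * G $ K =
        ordered_prod (J(m := I)) K * (\<Sum>e\<in>Basis. (G $ K \<bullet> e) *\<^sub>R e)"
      by (simp only: euclidean_representation)
    then show "ordered_prod (J(m := I)) K * G $ K =
        (\<Sum>e\<in>Basis. (G $ K \<bullet> e) *\<^sub>R (ordered_prod (J(m := I)) K * e))"
      by (simp add: sum_distrib_left)
  qed simp
  also have "\<dots> = (\<Sum>K\<in>UNIV. \<Sum>e\<in>Basis.
    if m \<in> K then \<Sum>i\<in>Basis - {1}.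
      ((q \<bullet> i) * (Im (stem_section F z m K e w) / Im w)) *\<^sub>R (ordered_prod (J(m := i)) K * e)
    else Re (stem_section F z m K e w) *\<^sub>R (ordered_prod J K * e))"
  proof (intro sum.cong refl)
    fix K and e :: quat
    show "(G $ K \<bullet> e) *\<^sub>R (ordered_prod (J(m := I)) K * e) =
      (if m \<in> K then \<Sum>i\<in>Basis - {1}.
        ((q \<bullet> i) * (Im (stem_section F z m K e w) / Im w)) *\<^sub>R (ordered_prod (J(m := i)) K * e)
      else Re (stem_section F z m K e w) *\<^sub>R (ordered_prod J K * e))"
    proof (cases "m \<in> K")
      case True
      then have G: "G $ K \<bullet> e = Im (stem_section F z m K e w)"
        by (simp add: stem_section_def G_def insert_absorb)
      have lin: "linear (\<lambda>i. ordered_prod (J(m := i)) K * e)"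
        using linear_compose[OF ordered_prod_linear[OF True, of J], of "\<lambda>p. p * e"]
        by (simp add: o_def linear_iff algebra_simps)
      \<comment> \<open>parity at a fixed point of the conjugation\<close>
      have "Im (stem_section F z m K e w) = 0" if "Im w = 0"
      proof -
        have "cnj w = w" using that by (simp add: complex_eq_iff)
        then have "stem_section F z m K e w = cnj (stem_section F z m K e w)"
          using stem_section_cnj[OF assms(2) w, of K e] unfolding w_def by (simp only:)
        from arg_cong[OF this, of Im] show ?thesis by simp
      qed
      from scaled_linear_on_unit[OF lin I(1) I(2)[unfolded w_def] this[unfolded w_def]]
      show ?thesis
        using True unfolding G by (simp add: w_def)
    next
      case False
      then have "G $ K \<bullet> e = Re (stem_section F z m K e w)"
        by (simp add: stem_section_def G_def)
      moreover have "ordered_prod (J(m := I)) K = ordered_prod J K"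
        using False by (intro ordered_prod_cong) auto
      ultimately show ?thesis using False by simp
    qed
  qed
  finally show ?thesis unfolding w_def .
qed

section \<open>Separate biharmonicity\<close>

lemma slice_regular_biharmonic_in_variable:
  assumes "open D" "invariant D" "holomorphic_stem_on D F" "induced_by D F f"
    and J: "\<And>h. J h \<in> imag_units"
  shows "biharmonic_on (\<lambda>q. f (replace_at (slice_point z J) m q))
    {q. replace_at z m (slice_coord q) \<in> D}"
proof -
  define U where "U = {w. replace_at z m w \<in> D}"
  have F: "stem_function_on D F" using assms(3) by (simp add: holomorphic_stem_on_def)
  have U: "open U"
    unfolding U_def using continuous_open_preimage[OF continuous_on_replace_at open_UNIV assms(1), of z m]
    by (simp add: vimage_def)
  have cnj: "cnj w \<in> U" if "w \<in> U" for w
    using that assms(2) unfolding U_def invariant_def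
    by (metis mem_Collect_eq replace_at_replace_at replace_at_nth_same)
  have S: "open {q. slice_coord q \<in> U}"
    using continuous_open_preimage[OF continuous_on_slice_coord open_UNIV U]
    by (simp add: vimage_def)
  have holo: "stem_section F z m K e holomorphic_on U"
    and sym: "\<And>w. w \<in> U \<Longrightarrow> stem_section F z m K e (cnj w) = cnj (stem_section F z m K e w)" for K e
    using stem_section_holomorphic[OF assms(1,3)] stem_section_cnj[OF F] by (simp_all add: U_def)
  note parts = biharmonic_on_slice_coord[OF U cnj holo sym]
  have "biharmonic_on (\<lambda>q. \<Sum>K\<in>UNIV. \<Sum>e\<in>Basis.
    if m \<in> K then \<Sum>i\<in>Basis - {1}.
      ((q \<bullet> i) * (Im (stem_section F z m K e (slice_coord q)) / Im (slice_coord q))) *\<^sub>R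
        (ordered_prod (J(m := i)) K * e)
    else Re (stem_section F z m K e (slice_coord q)) *\<^sub>R (ordered_prod J K * e))
    {q. slice_coord q \<in> U}"
  proof (intro biharmonic_on_sum S, goal_cases)
    case (1 K e)
    show ?case
    proof (cases "m \<in> K")
      case True
      have "biharmonic_on (\<lambda>q. \<Sum>i\<in>Basis - {1}.
          ((q \<bullet> i) * (Im (stem_section F z m K e (slice_coord q)) / Im (slice_coord q))) *\<^sub>R
            (ordered_prod (J(m := i)) K * e)) {q. slice_coord q \<in> U}"
        by (intro biharmonic_on_sum[OF S] parts(2)
            biharmonic_on_bounded_linear[OF S bounded_linear_scaleR_left]) auto
      with True show ?thesis by simp
    next
      case False
      have "biharmonic_on (\<lambda>q. Re (stem_section F z m K e (slice_coord q)) *\<^sub>R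
          (ordered_prod J K * e)) {q. slice_coord q \<in> U}"
        by (rule biharmonic_on_bounded_linear[OF S bounded_linear_scaleR_left parts(1)])
      with False show ?thesis by simp
    qed
  qed
  then have "biharmonic_on (\<lambda>q. f (replace_at (slice_point z J) m q)) {q. slice_coord q \<in> U}"
    by (rule biharmonic_on_cong[OF S, rotated])
      (subst slice_function_one_variable[OF assms(4) F J], simp_all add: U_def)
  then show ?thesis by (simp add: U_def)
qed

theorem corollary4p7:
  fixes D :: "(complex^'n::{finite,linorder}) set"
    and f :: "quat^'n::{finite,linorder} \<Rightarrow> quat"
  assumes "open D"
    and "invariant D"
    and "f \<in> slice_regular_functions D"
  shows "separately_biharmonic_on f (circularization D)"
proof -
  obtain F where F: "holomorphic_stem_on D F" "induced_by D F f"
    using assms(3) by (auto simp: slice_regular_functions_def)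
  have bih: "biharmonic_on (\<lambda>q. f (replace_at x m q)) {q. replace_at x m q \<in> circularization D}" for x m
  proof (rule biharmonic_on_locally, goal_cases)
    case (1 q0)
    then obtain z J where z: "z \<in> D" and J: "\<And>h. J h \<in> imag_units"
      and eq: "replace_at x m q0 = slice_point z J"
      by (auto simp: circularization_def)
    define T where "T = {q. replace_at z m (slice_coord q) \<in> D}"
    have "open {w. replace_at z m w \<in> D}"
      using continuous_open_preimage[OF continuous_on_replace_at open_UNIV assms(1), of z m]
      by (simp add: vimage_def)
    from continuous_open_preimage[OF continuous_on_slice_coord open_UNIV this]
    have "open T" by (simp add: vimage_def T_def)
    moreover have "q0 \<in> T"
    proof -
      have "q0 = of_real (Re (z $ m)) + J m * of_real (Im (z $ m))"
        using arg_cong[OF eq, of "\<lambda>v. v $ m"] by (simp add: replace_at_def slice_point_def)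
      \<comment> \<open>the representing point \<open>z\<close> may have negative imaginary part, whence the two cases\<close>
      then have "slice_coord q0 = Complex (Re (z $ m)) \<bar>Im (z $ m)\<bar>"
        by (simp add: slice_coord_slice[OF J])
      then have "slice_coord q0 = z $ m \<or> slice_coord q0 = cnj (z $ m)"
        by (auto simp: complex_eq_iff abs_if)
      moreover have "replace_at z m (z $ m) = z" by (simp add: vec_eq_iff replace_at_def)
      moreover have "replace_at z m (cnj (z $ m)) \<in> D"
        using assms(2) z by (simp add: invariant_def)
      ultimately show ?thesis using z by (auto simp: T_def)
    qed
    moreover have "replace_at x m = replace_at (slice_point z J) m"
      using eq by (metis ext replace_at_replace_at)
    then have "biharmonic_on (\<lambda>q. f (replace_at x m q)) T"
      using slice_regular_biharmonic_in_variable[OF assms(1,2) F J] by (simp add: T_def)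
    ultimately show ?case by blast
  qed
  show ?thesis
    unfolding separately_biharmonic_on_def Ck_in_var_def
  proof (intro allI conjI ballI)
    show "Ck_on 4 (\<lambda>q. f (replace_at x m q)) {q. replace_at x m q \<in> circularization D}" for m x
      using bih by (simp add: biharmonic_on_def)
    fix m x assume x: "x \<in> circularization D"
    have "var_laplacian m f (replace_at x m q) = laplacian (\<lambda>q. f (replace_at x m q)) q" for q
      by (simp add: var_laplacian_def replace_at_replace_at replace_at_nth_same)
    then have "(var_laplacian m ^^ 2) f x = laplacian (laplacian (\<lambda>q. f (replace_at x m q))) (x $ m)"
      by (simp add: numeral_2_eq_2 var_laplacian_def)
    also have "\<dots> = 0"
    proof -
      have "replace_at x m (x $ m) = x" by (simp add: vec_eq_iff replace_at_def)
      then show ?thesis using bih[of x m] x by (simp add: biharmonic_on_def)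
    qed
    finally show "(var_laplacian m ^^ 2) f x = 0" .
  qed
qed

end
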